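(* For every fixed $\varepsilon>0$, as $x\to\infty$, $$\#\{n<x : P^+(n)<P^+(n+1)<x^{41/107+\varepsilon}\}\gg x,$$ and likewise $$\#\{n<x : P^+(n+1)<P^+(n)<x^{41/107+\varepsilon}\}\gg x .$$ That is, for each $\varepsilon>0$ there are constants $\kappa=\kappa(\varepsilon)>0$ and $x_0=x_0(\varepsilon)$ such that both counts are at least $\kappa x$ for all $x\ge x_0$.
   Context: Here $n$ ranges over positive integers, and $P^+(n)$ denotes the largest prime factor of $n$, with the convention $P^+(1)=1$. *)

theory Defs
  imports Complex_Main "HOL-Computational_Algebra.Primes"
begin

text \<open>The largest prime factor \<open>P\<^sup>+(n)\<close>, with the convention \<open>P\<^sup>+(1) = 1\<close>.
  The value at 0 is a junk value; only positive arguments are used.\<close>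

definition largest_prime_factor :: "nat \<Rightarrow> nat" where
  "largest_prime_factor n = (if n \<le> 1 then 1 else Max (prime_factors n))"

end

theory Submission
  imports Defs "HOL-Number_Theory.Prime_Powers" "HOL-Number_Theory.Cong" "HOL-Analysis.Analysis"
    "HOL-Real_Asymp.Real_Asymp"
begin

text \<open>Let \<open>X\<close> be large and \<open>s\<close> be 1 or -1. Consider integers \<open>m\<close> up to \<open>X\<close> such that \<open>m\<close> is divisible by \<open>a = p t\<close> and \<open>m + s\<close> by
\<open>b = p' u\<close>, where \<open>p, p'\<close> are primes of size about \<open>X\<^sup>0\<^sup>.\<^sup>0\<^sup>7\<close> and \<open>t, u\<close> are primes of size about \<open>X\<^sup>0\<^sup>.\<^sup>3\<^sup>8\<close>,
all \<open>t\<close> being at most \<open>X\<^sup>0\<^sup>.\<^sup>3\<^sup>8\<close> and all \<open>u\<close> above it. Since \<open>a b\<close> is smaller than \<open>X\<close>,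
the number of triples \<open>(a, b, m)\<close> is asymptotically \<open>X\<close> times a product of four sums of reciprocals of primes, a positive
constant times \<open>X\<close>. If neither \<open>m div a\<close> nor \<open>(m + s) div b\<close> has a prime factor above this level, then \<open>u\<close> beats every prime factor of
\<open>m\<close> and is essentially the largest prime factor of \<open>m + s\<close>; so \<open>s\<close> decides which of two consecutive smooth integers has the larger
largest prime factor.

It remains to see that these large cofactors do not occur too often. A prime \<open>q\<close> above \<open>X\<^sup>0\<^sup>.\<^sup>3\<^sup>8\<close> that divides \<open>m div a\<close> is at most about
\<open>X\<^sup>0\<^sup>.\<^sup>5\<^sup>5\<^sup>1\<close>, and by Mertens the sum of \<open>1 / q\<close> over this range is less than
\<open>0.48\<close>. So if the expected number of bad triples is the true one, at least to within a factor close to 1, then the two members of the pair together lose a proportion of at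
most \<open>0.96\<close> of all triples, and a positive proportion survives. Each integer \<open>m\<close> belongs to boundedly many
triples because all the primes involved exceed a fixed power of \<open>X\<close>, which turns the count of triples into a count of integers.

The point is thus the distribution of the numbers \<open>m = p t q l\<close> in the class \<open>-s\<close> modulo \<open>b\<close>, where \<open>b\<close> has size nearly \<open>X\<^sup>1\<^sup>/\<^sup>2\<close>. This
is an instance of the Bombieri-Vinogradov phenomenon, but the small prime \<open>p\<close> makes an elementary argument possible. Write \<open>m = p k\<close>.
By Cauchy's inequality the structure of \<open>k\<close> may be forgotten: it is enough to bound the variance, over all integers \<open>k\<close>, of the
number of pairs \<open>(p, b)\<close> with \<open>b dvd p k + s\<close>. For two such pairs with coprime moduli \<open>b, b'\<close> the conditions are independent up to an
error \<open>O(1)\<close>, and \<open>b b'\<close> is below the length of the range of \<open>k\<close>; for moduli with a common factor they force a rare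
congruence between the two values of \<open>p\<close>. This is lemma \<open>sum_discrepancy_squared_le\<close>, and \<open>bilinear_count_le\<close>
draws the conclusion. The same lemma treats large cofactors of \<open>m + s\<close> after exchanging the two members of the pair.

The requirements are \<open>3 \<tau> + 2 \<alpha> < 1\<close> for the dispersion and \<open>(1 - \<tau> - 2 \<alpha>) / \<alpha> < 1 / 2\<close> for the density, where \<open>X\<^sup>\<tau>\<close> and
\<open>X\<^sup>\<alpha>\<close> are the sizes of the small and the large primes; \<open>\<tau> = 0.07\<close> and
\<open>\<alpha> = 0.38\<close> satisfy both with room for short ranges of exponents, and \<open>0.381\<close> is less than \<open>41 / 107\<close>.\<close>

section \<open>Mertens' first theorem\<close>

lemma prod_primes_dvd:
  fixes n :: nat
  assumes "finite S" "\<And>p. p \<in> S \<Longrightarrow> prime p \<and> p dvd n"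
  shows "\<Prod>S dvd n"
  using assms
proof (induction S rule: finite_induct)
  case (insert p S)
  have "coprime p (\<Prod>S)"
    using insert by (intro prod_coprime_right) (auto intro!: primes_coprime)
  then show ?case
    using insert by (simp add: divides_mult)
qed simp

definition primes_between :: "real \<Rightarrow> real \<Rightarrow> nat set" where
  "primes_between z w = {p. prime p \<and> z < real p \<and> real p \<le> w}"

lemma finite_primes_between [simp, intro]: "finite (primes_between z w)"
  by (rule finite_subset[of _ "{..nat \<lfloor>w\<rfloor>}"]) (auto simp: primes_between_def le_nat_floor)

text \<open>Every prime in \<open>(m, 2m]\<close> divides the central binomial coefficient, which is at most \<open>4 ^ m\<close>.
Halving \<open>n\<close> repeatedly turns this into a linear bound; the constant 4 leaves room for the extra
term \<open>ln n\<close>, which covers the case that \<open>n = 2m + 1\<close> is a prime.\<close>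

lemma chebyshev_theta_le: "(\<Sum>p | prime p \<and> p \<le> n. ln (real p)) \<le> 4 * real n"
proof (induction n rule: less_induct)
  case (less n)
  show ?case
  proof (cases "n \<le> 1")
    case True
    then have "{p. prime p \<and> p \<le> n} = {}"
      by (auto dest!: prime_ge_2_nat)
    then show ?thesis by (simp only: sum.empty)
  next
    case False
    define m where "m = n div 2"
    have m: "m < n" "m \<ge> 1" "n \<le> 2 * m + 1" "2 * m \<le> n" using False by (auto simp: m_def)
    define S where "S = {p. prime p \<and> m < p \<and> p \<le> 2 * m}"
    have finS: "finite S" by (rule finite_subset[of _ "{..2*m}"]) (auto simp: S_def)
    have "\<Prod>S dvd (2 * m) choose m"
    proof (rule prod_primes_dvd[OF finS])
      fix p assume "p \<in> S"
      then have p: "prime p" "m < p" "p \<le> 2 * m" by (auto simp: S_def)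
      have "fact m * fact (2 * m - m) * ((2 * m) choose m) = (fact (2 * m) :: nat)"
        by (rule binomial_fact_lemma) simp
      moreover have "p dvd (fact (2 * m) :: nat)" using p by (simp add: prime_dvd_fact_iff)
      ultimately have "p dvd fact m * fact m * ((2 * m) choose m)" by simp
      moreover have "\<not> p dvd (fact m :: nat)" using p by (simp add: prime_dvd_fact_iff)
      ultimately show "prime p \<and> p dvd (2 * m) choose m"
        using p by (auto simp: prime_dvd_mult_iff)
    qed
    then have "\<Prod>S \<le> (2 * m) choose m" by (rule dvd_imp_le) simp
    also have "\<dots> \<le> 2 ^ (2 * m)" by (rule binomial_le_pow2)
    finally have "real (\<Prod>S) \<le> 2 ^ (2 * m)"
      by (metis of_nat_le_iff of_nat_numeral of_nat_power)
    moreover have "real (\<Prod>S) > 0"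
      by (auto simp: S_def intro!: prod_pos dest: prime_gt_0_nat)
    ultimately have "ln (real (\<Prod>S)) \<le> ln (2 ^ (2 * m))" by (subst ln_le_cancel_iff) auto
    also have "\<dots> = 2 * real m * ln 2" by (simp add: ln_realpow)
    also have "\<dots> \<le> 2 * real m * 1" using ln_2_less_1 by (intro mult_left_mono) auto
    finally have "ln (real (\<Prod>S)) \<le> 2 * real m" by simp
    moreover have "ln (real (\<Prod>S)) = (\<Sum>p\<in>S. ln (real p))"
      unfolding of_nat_prod
      by (subst ln_prod) (auto simp: S_def finS[unfolded S_def] dest: prime_gt_0_nat)
    ultimately have S: "(\<Sum>p\<in>S. ln (real p)) \<le> 2 * real m" by simp
    have "(\<Sum>p | prime p \<and> p \<le> n. ln (real p)) \<le>
        (\<Sum>p \<in> ({p. prime p \<and> p \<le> m} \<union> S) \<union> {n}. ln (real p))"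
      using finS m by (intro sum_mono2) (auto simp: S_def dest: prime_ge_1_nat)
    also have "\<dots> \<le> (\<Sum>p \<in> {p. prime p \<and> p \<le> m} \<union> S. ln (real p)) + (\<Sum>p\<in>{n}. ln (real p))"
      using finS m by (subst sum_Un) (auto intro!: sum_nonneg)
    also have "(\<Sum>p \<in> {p. prime p \<and> p \<le> m} \<union> S. ln (real p)) =
        (\<Sum>p | prime p \<and> p \<le> m. ln (real p)) + (\<Sum>p\<in>S. ln (real p))"
      using finS by (intro sum.union_disjoint) (auto simp: S_def)
    also have "(\<Sum>p\<in>{n}. ln (real p)) = ln (real n)" by simp
    finally have "(\<Sum>p | prime p \<and> p \<le> n. ln (real p)) \<le> 4 * real m + 2 * real m + ln (real n)"
      using less.IH[OF m(1)] S by linarith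
    also have "ln (real n) \<le> real n - 1" using False by (intro ln_le_minus_one) auto
    also have "4 * real m + 2 * real m + (real n - 1) \<le> 4 * real n"
    proof -
      have "2 * real m \<le> real n" "real n \<le> 2 * real m + 1"
        using m(3,4) by linarith+
      then show ?thesis by linarith
    qed
    finally show ?thesis by simp
  qed
qed

lemma ln_fact_le: "ln (fact n :: real) \<le> real n * ln (real n)"
proof (cases "n = 0")
  case False
  have "ln (fact n :: real) \<le> ln (real n ^ n)"
    using fact_le_power[of n, where ?'a = real] False by (subst ln_le_cancel_iff) (auto intro: of_nat_0_less_iff)
  then show ?thesis using False by (simp add: ln_realpow)
qed simp

lemma ln_fact_ge: "n \<ge> 1 \<Longrightarrow> ln (fact n :: real) \<ge> real n * ln (real n) - real n"
proof (induction n rule: dec_induct)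
  case (step n)
  have "ln (1 + 1 / real n) \<le> 1 / real n" by (intro ln_add_one_self_le_self) auto
  moreover have "1 + 1 / real n = (real n + 1) / real n" using step by (simp add: field_simps)
  moreover have "ln ((real n + 1) / real n) = ln (real n + 1) - ln (real n)"
    using step by (subst ln_div) auto
  ultimately have "real n * (ln (real n + 1) - ln (real n)) \<le> real n * (1 / real n)"
    by (intro mult_left_mono) auto
  then have *: "real n * ln (real n + 1) - real n * ln (real n) \<le> 1"
    using step by (simp add: algebra_simps)
  have "ln (fact (Suc n) :: real) = ln (real (Suc n) * fact n)" by simp
  also have "\<dots> = ln (real (Suc n)) + ln (fact n)" by (subst ln_mult) auto
  finally show ?case using step * by (simp add: algebra_simps)
qed simp

lemma card_multiples: "d > 0 \<Longrightarrow> card {m \<in> {1..n}. d dvd m} = n div (d::nat)"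
proof -
  assume d: "d > 0"
  have "{m \<in> {1..n}. d dvd m} = (\<lambda>j. d * j) ` {1..n div d}"
    using d by (auto simp: image_iff less_eq_div_iff_mult_less_eq mult.commute Suc_le_eq elim!: dvdE)
  moreover have "inj_on (\<lambda>j. d * j) {1..n div d}" using d by (auto simp: inj_on_def)
  ultimately show ?thesis by (simp add: card_image)
qed

text \<open>Legendre's formula for \<open>n!\<close>: write each \<open>ln m\<close> as a divisor sum of the von Mangoldt function
and count the multiples of \<open>d\<close>.\<close>

lemma sum_mangoldt_div: "(\<Sum>d\<in>{1..n}. mangoldt d * real (n div d)) = ln (fact n :: real)"
proof -
  have "ln (fact n :: real) = (\<Sum>m\<in>{1..n}. ln (real m))"
    unfolding fact_prod of_nat_prod by (subst ln_prod) auto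
  also have "\<dots> = (\<Sum>m\<in>{1..n}. \<Sum>d | d dvd m. mangoldt d)"
    by (intro sum.cong refl) (simp add: mangoldt_sum)
  also have "\<dots> = (\<Sum>m\<in>{1..n}. \<Sum>d\<in>{1..n}. if d dvd m then mangoldt d else 0)"
  proof (rule sum.cong[OF refl])
    fix m assume m: "m \<in> {1..n}"
    have "(\<Sum>d\<in>{1..n}. if d dvd m then mangoldt d else 0) = (\<Sum>d\<in>{d\<in>{1..n}. d dvd m}. mangoldt d :: real)"
      by (subst sum.inter_filter) auto
    also have "{d\<in>{1..n}. d dvd m} = {d. d dvd m}"
    proof (intro equalityI subsetI)
      fix d assume "d \<in> {d. d dvd m}"
      then have "d dvd m" by simp
      moreover have "d > 0" "d \<le> m" using m dvd_pos_nat[OF _ \<open>d dvd m\<close>] dvd_imp_le[OF \<open>d dvd m\<close>] by auto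
      ultimately show "d \<in> {d\<in>{1..n}. d dvd m}" using m by auto
    qed auto
    finally show "(\<Sum>d | d dvd m. mangoldt d) = (\<Sum>d\<in>{1..n}. if d dvd m then mangoldt d else (0::real))"
      by simp
  qed
  also have "\<dots> = (\<Sum>d\<in>{1..n}. \<Sum>m\<in>{1..n}. if d dvd m then mangoldt d else 0)"
    by (rule sum.swap)
  also have "\<dots> = (\<Sum>d\<in>{1..n}. mangoldt d * real (n div d))"
  proof (intro sum.cong refl)
    fix d assume d: "d \<in> {1..n}"
    have "(\<Sum>m\<in>{1..n}. if d dvd m then mangoldt d else 0) = (\<Sum>m\<in>{m\<in>{1..n}. d dvd m}. mangoldt d :: real)"
      by (subst sum.inter_filter) auto
    also have "\<dots> = mangoldt d * real (n div d)"
      using d card_multiples[of d n] by simp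
    finally show "(\<Sum>m\<in>{1..n}. if d dvd m then mangoldt d else 0) = (mangoldt d * real (n div d) :: real)" .
  qed
  finally show ?thesis by simp
qed

lemma real_div_le_nat_div_add_1: "d > 0 \<Longrightarrow> real n / real d \<le> real (n div d) + 1"
proof -
  assume d: "d > 0"
  have "n \<le> n div d * d + d"
    using mod_less_divisor[OF d, of n] div_mult_mod_eq[of n d] by linarith
  then have "real n \<le> real (n div d * d + d)" by (rule of_nat_mono)
  then show ?thesis using d by (simp add: field_simps)
qed

text \<open>In Legendre's formula the primes alone contribute at most \<open>ln n!\<close>, and replacing the integer parts
\<open>n div p\<close> by \<open>n / p\<close> costs at most the Chebyshev sum, which is linear in \<open>n\<close>.\<close>

lemma sum_ln_prime_div_le:
  assumes "n \<ge> 1"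
  shows "(\<Sum>p | prime p \<and> p \<le> n. ln (real p) / real p) \<le> ln (real n) + 4"
proof -
  let ?P = "{p. prime p \<and> p \<le> n}"
  have "real n * (\<Sum>p\<in>?P. ln (real p) / real p) = (\<Sum>p\<in>?P. ln (real p) * (real n / real p))"
    by (simp add: sum_distrib_left mult_ac)
  also have "\<dots> \<le> (\<Sum>p\<in>?P. ln (real p) * (real (n div p) + 1))"
  proof (intro sum_mono mult_left_mono)
    fix p assume "p \<in> ?P"
    then have p: "prime p" by simp
    show "real n / real p \<le> real (n div p) + 1"
      using prime_gt_0_nat[OF p] by (rule real_div_le_nat_div_add_1)
    show "0 \<le> ln (real p)" using prime_ge_1_nat[OF p] by simp
  qed
  also have "\<dots> = (\<Sum>p\<in>?P. ln (real p) * real (n div p)) + (\<Sum>p\<in>?P. ln (real p))"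
    by (simp add: algebra_simps sum.distrib)
  also have "(\<Sum>p\<in>?P. ln (real p) * real (n div p)) = (\<Sum>p\<in>?P. mangoldt p * real (n div p))"
    by (intro sum.cong) auto
  also have "\<dots> \<le> (\<Sum>d\<in>{1..n}. mangoldt d * real (n div d))"
    by (intro sum_mono2) (auto intro!: mult_nonneg_nonneg mangoldt_nonneg dest: prime_ge_1_nat)
  also have "\<dots> \<le> real n * ln (real n)" using sum_mangoldt_div ln_fact_le by simp
  also have "(\<Sum>p\<in>?P. ln (real p)) \<le> 4 * real n" by (rule chebyshev_theta_le)
  finally have "real n * (\<Sum>p\<in>?P. ln (real p) / real p) \<le> real n * (ln (real n) + 4)"
    by (simp add: algebra_simps)
  then show ?thesis using assms by (simp add: mult_le_cancel_left)
qed

text \<open>Squares and higher powers of primes are too sparse to matter: the powers of one prime \<open>p\<close> contribute at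
most \<open>2 ln p / p\<^sup>2\<close>, and \<open>ln p\<close> is at most \<open>2 p\<^sup>1\<^sup>/\<^sup>2\<close>, which gives a convergent series.\<close>

lemma sum_mangoldt_proper_powers_bounded:
  obtains C where "\<And>n. (\<Sum>d\<in>{d\<in>{1..n}. \<not> prime d}. mangoldt d / real d) \<le> C"
proof -
  have summ: "summable (\<lambda>p::nat. 4 * real p powr (-3/2))"
    by (intro summable_mult) (simp add: summable_real_powr_iff)
  have "(\<Sum>d\<in>{d\<in>{1..n}. \<not> prime d}. mangoldt d / real d) \<le> (\<Sum>p. 4 * real p powr (-3/2))" for n
  proof -
    \<comment> \<open>Both the base and the exponent of a prime power up to \<open>n\<close> are at most \<open>n\<close>, which gives a finite box to sum over.\<close>
    let ?D = "{d\<in>{1..n}. \<not> prime d \<and> primepow d}"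
    let ?f = "\<lambda>(p::nat, k::nat). p ^ k"
    let ?I = "{2..n} \<times> {2..n}"
    have "(\<Sum>d\<in>{d\<in>{1..n}. \<not> prime d}. mangoldt d / real d) = (\<Sum>d\<in>?D. mangoldt d / real d)"
      by (intro sum.mono_neutral_right) (auto simp: mangoldt_def)
    also have "\<dots> \<le> (\<Sum>d\<in>?f ` (?I \<inter> {(p, k). prime p}). mangoldt d / real d)"
    proof (intro sum_mono2)
      show "?D \<subseteq> ?f ` (?I \<inter> {(p, k). prime p})"
      proof
        fix d assume d: "d \<in> ?D"
        then obtain p k where pk: "prime p" "k > 0" "d = p ^ k" by (auto simp: primepow_def)
        have "k \<noteq> 1" using d pk by auto
        then have k: "k \<ge> 2" using pk by simp
        have "p ^ 1 \<le> p ^ k" using pk prime_ge_1_nat by (intro power_increasing) auto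
        moreover have "k < p ^ k" using prime_ge_2_nat[OF pk(1)] by (intro power_gt_expt) auto
        ultimately have "p \<le> n" "k \<le> n" using d pk by auto
        then show "d \<in> ?f ` (?I \<inter> {(p, k). prime p})"
          using pk k prime_ge_2_nat[OF pk(1)] by (auto simp: image_iff intro!: bexI[of _ "(p, k)"])
      qed
    qed (auto intro!: divide_nonneg_nonneg mangoldt_nonneg)
    also have "\<dots> \<le> (\<Sum>x\<in>?I \<inter> {(p, k). prime p}. mangoldt (?f x) / real (?f x))"
      using sum_image_le[of "?I \<inter> {(p, k). prime p}" "\<lambda>d. mangoldt d / real d" ?f]
      by (auto simp: o_def intro!: divide_nonneg_nonneg mangoldt_nonneg)
    also have "\<dots> = (\<Sum>(p,k)\<in>?I \<inter> {(p, k). prime p}. ln (real p) / real p ^ k)"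
      by (intro sum.cong refl) auto
    also have "\<dots> \<le> (\<Sum>(p,k)\<in>?I. ln (real p) / real p ^ k)"
      by (intro sum_mono2) auto
    also have "\<dots> = (\<Sum>p\<in>{2..n}. \<Sum>k\<in>{2..n}. ln (real p) / real p ^ k)"
      by (simp add: sum.cartesian_product)
    also have "\<dots> \<le> (\<Sum>p\<in>{2..n}. 4 * real p powr (-3/2))"
    proof (intro sum_mono)
      fix p assume "p \<in> {2..n}"
      then have p: "p \<ge> 2" by auto
      have "(\<Sum>k\<in>{2..n}. (1 / real p) ^ k) \<le> 2 / real p ^ 2"
      proof (cases "n \<ge> 2")
        case True
        have "(\<Sum>k\<in>{2..n}. (1 / real p) ^ k) = ((1/real p)^2 - (1/real p)^Suc n) / (1 - 1/real p)"
          using True p by (subst sum_gp) auto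
        also have "\<dots> \<le> (1/real p)^2 / (1/2)"
          using p by (intro frac_le) (auto simp: field_simps)
        finally show ?thesis by (simp add: power_divide)
      qed simp
      then have "(\<Sum>k\<in>{2..n}. ln (real p) / real p ^ k) \<le> ln (real p) * (2 / real p ^ 2)"
        using p by (auto simp: power_divide divide_inverse sum_distrib_left[symmetric] power_inverse intro!: mult_left_mono)
      also have "ln (real p) \<le> 2 * real p powr (1/2)"
        using ln_powr_bound[of "real p" "1/2"] p by simp
      then have "ln (real p) * (2 / real p ^ 2) \<le> 2 * real p powr (1/2) * (2 / real p ^ 2)"
        by (intro mult_right_mono) auto
      also have "\<dots> = 4 * (real p powr (1/2) / real p powr (2::real))" using p by (subst powr_numeral) auto
      also have "real p powr (1/2) / real p powr (2::real) = real p powr (-3/2)"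
        by (subst powr_diff[symmetric]) simp
      finally show "(\<Sum>k\<in>{2..n}. ln (real p) / real p ^ k) \<le> 4 * real p powr (-3/2)" .
    qed
    also have "\<dots> \<le> (\<Sum>p. 4 * real p powr (-3/2))"
      using summ by (intro sum_le_suminf) auto
    finally show ?thesis .
  qed
  then show ?thesis by (rule that)
qed

text \<open>Rounding \<open>n div d\<close> up to \<open>n / d\<close> in Legendre's formula bounds \<open>ln n!\<close> from above by \<open>n\<close> times the sum
of \<open>\<Lambda>(d) / d\<close>, where only the terms with prime \<open>d\<close> make an unbounded contribution.\<close>

lemma sum_ln_prime_div_ge:
  obtains C where "\<And>n. n \<ge> 1 \<Longrightarrow> (\<Sum>p | prime p \<and> p \<le> n. ln (real p) / real p) \<ge> ln (real n) - C"
proof -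
  obtain C where C: "\<And>n. (\<Sum>d\<in>{d\<in>{1..n}. \<not> prime d}. mangoldt d / real d) \<le> C"
    using sum_mangoldt_proper_powers_bounded by blast
  have "(\<Sum>p | prime p \<and> p \<le> n. ln (real p) / real p) \<ge> ln (real n) - (C + 1)" if n: "n \<ge> 1" for n
  proof -
    have eq: "{p. prime p \<and> p \<le> n} = {d\<in>{1..n}. prime d}" by (auto dest: prime_ge_1_nat)
    have "real n * ln (real n) - real n \<le> (\<Sum>d\<in>{1..n}. mangoldt d * real (n div d))"
      using ln_fact_ge[OF n] sum_mangoldt_div[of n] by simp
    also have "\<dots> \<le> (\<Sum>d\<in>{1..n}. real n * (mangoldt d / real d))"
    proof (intro sum_mono)
      fix d assume "d \<in> {1..n}"
      have "real (n div d) \<le> real n / real d" by (rule of_nat_div_le_of_nat)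
      then have "mangoldt d * real (n div d) \<le> mangoldt d * (real n / real d)"
        by (intro mult_left_mono mangoldt_nonneg)
      then show "mangoldt d * real (n div d) \<le> real n * (mangoldt d / real d)" by (simp add: mult_ac)
    qed
    also have "\<dots> = real n * (\<Sum>d\<in>{1..n}. mangoldt d / real d)" by (simp add: sum_distrib_left)
    also have "(\<Sum>d\<in>{1..n}. mangoldt d / real d) =
      (\<Sum>d\<in>{d\<in>{1..n}. prime d}. mangoldt d / real d) + (\<Sum>d\<in>{d\<in>{1..n}. \<not> prime d}. mangoldt d / real d)"
      by (subst sum.union_disjoint[symmetric]) (auto intro!: sum.cong)
    also have "(\<Sum>d\<in>{d\<in>{1..n}. prime d}. mangoldt d / real d) = (\<Sum>p | prime p \<and> p \<le> n. ln (real p) / real p)"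
      unfolding eq by (intro sum.cong) auto
    finally have "real n * (ln (real n) - 1) \<le> real n * ((\<Sum>p | prime p \<and> p \<le> n. ln (real p) / real p) +
       (\<Sum>d\<in>{d\<in>{1..n}. \<not> prime d}. mangoldt d / real d))" by (simp add: algebra_simps)
    then have "ln (real n) - 1 \<le> (\<Sum>p | prime p \<and> p \<le> n. ln (real p) / real p) +
       (\<Sum>d\<in>{d\<in>{1..n}. \<not> prime d}. mangoldt d / real d)"
      using n by (simp add: mult_le_cancel_left)
    then show ?thesis using C[of n] by linarith
  qed
  then show ?thesis by (rule that)
qed

lemma mertens_interval:
  obtains C where "C > 0"
    "\<And>z w. 1 \<le> z \<Longrightarrow> z \<le> w \<Longrightarrow> \<bar>(\<Sum>p\<in>primes_between z w. ln (real p) / real p) - (ln w - ln z)\<bar> \<le> C"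
proof -
  obtain C where C: "\<And>n. n \<ge> 1 \<Longrightarrow> (\<Sum>p | prime p \<and> p \<le> n. ln (real p) / real p) \<ge> ln (real n) - C"
    using sum_ln_prime_div_ge by blast
  define M where "M = (\<lambda>n::nat. \<Sum>p | prime p \<and> p \<le> n. ln (real p) / real p)"
  have Mb: "ln x - \<bar>C\<bar> - 1 \<le> M (nat \<lfloor>x\<rfloor>) \<and> M (nat \<lfloor>x\<rfloor>) \<le> ln x + 4" if x: "x \<ge> 1" for x
  proof -
    define n where "n = nat \<lfloor>x\<rfloor>"
    have n: "n \<ge> 1" "real n \<le> x" "x \<le> real n + 1"
      using x of_nat_floor[of x] real_nat_ceiling_ge[of x] by (auto simp: n_def le_nat_floor)
    have "ln (real n) \<le> ln x" using n by simp
    moreover have "ln x \<le> ln (2 * real n)" using n x by (subst ln_le_cancel_iff) auto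
    moreover have "ln (2 * real n) = ln 2 + ln (real n)" using n by (simp add: ln_mult)
    moreover note ln_2_less_1 C[OF n(1)] sum_ln_prime_div_le[OF n(1)]
    ultimately show ?thesis unfolding M_def n_def[symmetric] by linarith
  qed
  show ?thesis
  proof (rule that[of "\<bar>C\<bar> + 5"])
    fix z w :: real assume zw: "1 \<le> z" "z \<le> w"
    have "M (nat \<lfloor>w\<rfloor>) = M (nat \<lfloor>z\<rfloor>) + (\<Sum>p\<in>primes_between z w. ln (real p) / real p)"
    proof -
      have iff: "p \<le> nat \<lfloor>t\<rfloor> \<longleftrightarrow> real p \<le> t" if "t \<ge> 1" for t p
        using that by (simp add: le_nat_iff le_floor_iff)
      have "{p. prime p \<and> p \<le> nat \<lfloor>w\<rfloor>} = {p. prime p \<and> p \<le> nat \<lfloor>z\<rfloor>} \<union> primes_between z w"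
        using zw by (auto simp: iff primes_between_def)
      moreover have "{p. prime p \<and> p \<le> nat \<lfloor>z\<rfloor>} \<inter> primes_between z w = {}"
        using zw by (auto simp: iff primes_between_def)
      ultimately show ?thesis
        unfolding M_def by (simp add: sum.union_disjoint)
    qed
    then show "\<bar>(\<Sum>p\<in>primes_between z w. ln (real p) / real p) - (ln w - ln z)\<bar> \<le> \<bar>C\<bar> + 5"
      using Mb[of z] Mb[of w] zw by linarith
  qed auto
qed

text \<open>The factor \<open>ln p\<close> lies between \<open>ln z\<close> and \<open>ln w\<close>, so it can be divided out of the Mertens sum. This is
cruder than Mertens' second theorem, but nearly as good when \<open>w\<close> is a power of \<open>z\<close> with exponent close to 1.\<close>

lemma sum_inverse_primes_between:
  obtains C where "C > 0"
    "\<And>z w. 1 < z \<Longrightarrow> z \<le> w \<Longrightarrow> (\<Sum>p\<in>primes_between z w. 1 / real p) \<le> (ln w - ln z + C) / ln z"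
    "\<And>z w. 1 < z \<Longrightarrow> z \<le> w \<Longrightarrow> (\<Sum>p\<in>primes_between z w. 1 / real p) \<ge> (ln w - ln z - C) / ln w"
proof -
  obtain C where C: "C > 0" "\<And>z w. 1 \<le> z \<Longrightarrow> z \<le> w \<Longrightarrow>
     \<bar>(\<Sum>p\<in>primes_between z w. ln (real p) / real p) - (ln w - ln z)\<bar> \<le> C"
    using mertens_interval by blast
  show ?thesis
  proof (rule that[OF C(1)])
    fix z w :: real assume zw: "1 < z" "z \<le> w"
    let ?S = "\<Sum>p\<in>primes_between z w. 1 / real p"
    let ?L = "\<Sum>p\<in>primes_between z w. ln (real p) / real p"
    have "ln z * ?S \<le> ?L" unfolding sum_distrib_left
      using zw by (intro sum_mono) (auto simp: primes_between_def field_simps)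
    moreover have "?L \<le> ln w * ?S" unfolding sum_distrib_left
      using zw by (intro sum_mono) (auto simp: primes_between_def divide_le_cancel)
    moreover have "\<bar>?L - (ln w - ln z)\<bar> \<le> C" using C(2) zw by auto
    moreover have "ln z > 0" "ln w > 0" using zw by auto
    ultimately show "?S \<le> (ln w - ln z + C) / ln z" "?S \<ge> (ln w - ln z - C) / ln w"
      by (auto simp: field_simps)
  qed
qed

section \<open>Linear congruences and their correlations\<close>

lemma card_congruent_le:
  fixes S :: "nat set"
  assumes "L \<ge> 1" "S \<subseteq> {1..Y}" "\<And>x y. x \<in> S \<Longrightarrow> y \<in> S \<Longrightarrow> [x = y] (mod L)"
  shows "real (card S) \<le> real Y / real L + 1"
proof -
  \<comment> \<open>Congruent elements of the same block of length \<open>L\<close> coincide, and there are \<open>Y div L + 1\<close> blocks.\<close>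
  have inj: "inj_on (\<lambda>x. x div L) S"
  proof (rule inj_onI)
    fix x y assume xy: "x \<in> S" "y \<in> S" "x div L = y div L"
    have "x mod L = y mod L" using assms(3)[OF xy(1,2)] unfolding unique_euclidean_semiring_class.cong_def .
    then show "x = y" using xy(3) by (metis div_mult_mod_eq)
  qed
  have "(\<lambda>x. x div L) ` S \<subseteq> {0..Y div L}" by (auto intro!: div_le_mono dest!: subsetD[OF assms(2)])
  then have "card S \<le> card {0..Y div L}"
    using card_image[OF inj] by (metis card_mono finite_atLeastAtMost)
  then have "real (card S) \<le> real (Y div L) + 1" by simp
  also have "real (Y div L) \<le> real Y / real L" by (rule of_nat_div_le_of_nat)
  finally show ?thesis by simp
qed

lemma card_congruent_ge:
  fixes c :: int
  assumes "L \<ge> 1"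
  shows "real (card {k\<in>{1..Y}. [int k = c] (mod int L)}) \<ge> real Y / real L - 1"
proof -
  define r where "r = nat (c mod int L)"
  have r: "r < L" "[int r = c] (mod int L)" using assms by (auto simp: r_def nat_less_iff cong_def)
  \<comment> \<open>The progression through \<open>r\<close> starts one period later if \<open>r = 0\<close>, because 0 is outside the range.\<close>
  let ?f = "\<lambda>j. r + j * L + (if r = 0 then L else 0)"
  have inj: "inj_on ?f {0..<Y div L}" using assms by (auto simp: inj_on_def)
  have "?f ` {0..<Y div L} \<subseteq> {k\<in>{1..Y}. [int k = c] (mod int L)}"
  proof safe
    fix j assume "j \<in> {0..<Y div L}"
    then have "Suc j * L \<le> Y div L * L" by (intro mult_le_mono1) auto
    also have "\<dots> \<le> Y" by (rule div_times_less_eq_dividend)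
    finally have "j * L + L \<le> Y" by simp
    then show "?f j \<in> {1..Y}" using r(1) by auto
    have "[int (?f j) = int r] (mod int L)" by (auto simp: cong_iff_dvd_diff algebra_simps)
    then show "[int (?f j) = c] (mod int L)" using r(2) cong_trans by blast
  qed
  then have "Y div L \<le> card {k\<in>{1..Y}. [int k = c] (mod int L)}"
    using card_mono[of "{k\<in>{1..Y}. [int k = c] (mod int L)}" "?f ` {0..<Y div L}"] card_image[OF inj] by simp
  moreover have "real Y / real L \<le> real (Y div L) + 1"
    using assms by (intro real_div_le_nat_div_add_1) simp
  ultimately show ?thesis by linarith
qed

definition solutions :: "nat \<Rightarrow> int \<Rightarrow> nat \<Rightarrow> nat \<Rightarrow> nat set" where
  "solutions Y s a b = {k\<in>{1..Y}. int b dvd int (a * k) + s}"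

lemma finite_solutions [simp, intro]: "finite (solutions Y s a b)"
  by (simp add: solutions_def)

lemma card_solutions_ge:
  assumes "b \<ge> 1" "coprime a b"
  shows "real (card (solutions Y s a b)) \<ge> real Y / real b - 1"
proof -
  have "coprime (int a) (int b)" using assms by simp
  then obtain x where x: "[int a * x = - s] (mod int b)" using cong_solve_coprime_int
    by (metis cong_scalar_right mult.assoc mult_1 mult.commute)
  have "{k\<in>{1..Y}. [int k = x] (mod int b)} \<subseteq> solutions Y s a b"
  proof safe
    fix k assume k: "k \<in> {1..Y}" "[int k = x] (mod int b)"
    have "[int a * int k = int a * x] (mod int b)" using k(2) by (rule cong_scalar_left)
    then have "[int a * int k = - s] (mod int b)" using x cong_trans by blast
    then show "k \<in> solutions Y s a b" using k(1) by (auto simp: solutions_def cong_iff_dvd_diff)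
  qed
  then have "card {k\<in>{1..Y}. [int k = x] (mod int b)} \<le> card (solutions Y s a b)"
    by (intro card_mono) auto
  then show ?thesis using card_congruent_ge[OF assms(1), of Y x] by linarith
qed

lemma solutions_cong:
  assumes "coprime a b" "k \<in> solutions Y s a b" "l \<in> solutions Y s a b"
  shows "[k = l] (mod b)"
proof -
  have "int b dvd (int (a * k) + s) - (int (a * l) + s)"
    using assms(2,3) by (intro dvd_diff) (auto simp: solutions_def)
  then have "int b dvd int a * (int k - int l)" by (simp add: algebra_simps)
  moreover have "coprime (int b) (int a)" using assms(1) by (simp add: coprime_commute)
  ultimately have "int b dvd int k - int l" by (simp add: coprime_dvd_mult_right_iff)
  then show ?thesis by (simp add: cong_int_iff[symmetric] cong_iff_dvd_diff)
qed

text \<open>A simultaneous solution \<open>k\<close> is coprime to every common divisor of the moduli, because a common factor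
would divide \<open>s\<close>. Subtracting the two congruences therefore identifies \<open>a\<close> with \<open>a'\<close>
modulo the common divisor. This is what makes moduli with a common factor harmless later on.\<close>

lemma solutions_common_gcd:
  assumes "coprime a b" "coprime a' b'" "k \<in> solutions Y s a b" "k \<in> solutions Y s a' b'" "coprime s (int (gcd b b'))"
  shows "[a = a'] (mod gcd b b')"
proof -
  let ?g = "int (gcd b b')"
  have 1: "?g dvd int (a * k) + s" "?g dvd int (a' * k) + s"
    using assms(3,4) by (auto simp: solutions_def intro: dvd_trans[rotated])
  then have "?g dvd (int (a * k) + s) - (int (a' * k) + s)" by (rule dvd_diff)
  then have 2: "?g dvd int k * (int a - int a')" by (simp add: algebra_simps)
  have "coprime ?g (int k)"
  proof (rule coprimeI)
    fix c assume c: "c dvd ?g" "c dvd int k"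
    then have "c dvd (int (a * k) + s)" using 1 dvd_trans by blast
    then have "c dvd s" using c(2) by (simp add: dvd_add_right_iff)
    then show "is_unit c" using assms(5) c(1) coprime_common_divisor by blast
  qed
  then have "?g dvd int a - int a'" using 2 by (simp add: coprime_dvd_mult_right_iff)
  then show ?thesis by (metis cong_iff_dvd_diff cong_int_iff)
qed

lemma card_solutions_Int_le:
  assumes "b \<ge> 1" "b' \<ge> 1" "coprime a b" "coprime a' b'"
  shows "real (card (solutions Y s a b \<inter> solutions Y s a' b')) \<le> real Y * real (gcd b b') / (real b * real b') + 1"
proof -
  have "real (card (solutions Y s a b \<inter> solutions Y s a' b')) \<le> real Y / real (lcm b b') + 1"
  proof (rule card_congruent_le)
    show "1 \<le> lcm b b'" using assms by (simp add: Suc_le_eq lcm_pos_nat)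
    show "solutions Y s a b \<inter> solutions Y s a' b' \<subseteq> {1..Y}" by (auto simp: solutions_def)
    fix x y assume "x \<in> solutions Y s a b \<inter> solutions Y s a' b'" "y \<in> solutions Y s a b \<inter> solutions Y s a' b'"
    then have "[x = y] (mod b)" "[x = y] (mod b')" using assms solutions_cong by blast+
    then have "int b dvd int x - int y" "int b' dvd int x - int y"
      by (auto simp: cong_int_iff[symmetric] cong_iff_dvd_diff)
    then have "lcm (int b) (int b') dvd int x - int y" by (rule lcm_least)
    then show "[x = y] (mod lcm b b')"
      by (simp add: cong_int_iff[symmetric] cong_iff_dvd_diff lcm_int_int_eq)
  qed
  also have "real (lcm b b') = real b * real b' / real (gcd b b')"
    using prod_gcd_lcm_nat[of b b'] assms
    by (metis gcd_eq_0_iff nonzero_mult_div_cancel_left not_one_le_zero of_nat_eq_0_iff of_nat_mult)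
  finally show ?thesis using assms by simp
qed

text \<open>The events \<open>b dvd a * k + s\<close> behave like independent events of probability \<open>1 / b\<close>. For coprime moduli
their covariance is bounded by the rounding errors in the Chinese remainder theorem. A common factor
of the moduli creates a genuine correlation, but only if \<open>a\<close> and \<open>a'\<close> are congruent
modulo that factor; otherwise the two events exclude each other.\<close>

lemma solutions_covariance_le:
  assumes b: "b \<ge> 1" "b' \<ge> 1" and ab: "coprime a b" "coprime a' b'" and s: "\<bar>s\<bar> = 1"
  shows "(\<Sum>k\<in>{1..Y}. (of_bool (k \<in> solutions Y s a b) - 1 / real b) * (of_bool (k \<in> solutions Y s a' b') - 1 / real b'))
    \<le> 3 + of_bool (gcd b b' > 1 \<and> [a = a'] (mod gcd b b')) * (real Y * real (gcd b b') / (real b * real b'))"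
proof -
  let ?E = "solutions Y s a b" and ?E' = "solutions Y s a' b'"
  have sub: "?E \<subseteq> {1..Y}" "?E' \<subseteq> {1..Y}" by (auto simp: solutions_def)
  have c: "(\<Sum>k\<in>{1..Y}. of_bool (k \<in> S) :: real) = real (card S)" if "S \<subseteq> {1..Y}" for S
    using that by (simp add: Int_absorb1)
  have "(\<Sum>k\<in>{1..Y}. (of_bool (k \<in> ?E) - 1 / real b) * (of_bool (k \<in> ?E') - 1 / real b'))
     = (\<Sum>k\<in>{1..Y}. of_bool (k \<in> ?E \<inter> ?E') - of_bool (k \<in> ?E) / real b' - of_bool (k \<in> ?E') / real b + 1 / (real b * real b'))"
    by (intro sum.cong refl) (auto simp: algebra_simps)
  also have "\<dots> = real (card (?E \<inter> ?E')) - real (card ?E) / real b' - real (card ?E') / real b + real Y / (real b * real b')"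
    using sub c[of "?E \<inter> ?E'"] c[of ?E] c[of ?E']
    by (simp add: sum.distrib sum_subtractf sum_divide_distrib[symmetric] del: sum_of_bool_eq) (auto simp: le_infI1)
  finally have eq: "(\<Sum>k\<in>{1..Y}. (of_bool (k \<in> ?E) - 1 / real b) * (of_bool (k \<in> ?E') - 1 / real b'))
     = real (card (?E \<inter> ?E')) - real (card ?E) / real b' - real (card ?E') / real b + real Y / (real b * real b')" .
  have "real (card ?E) / real b' \<ge> (real Y / real b - 1) / real b'"
    using card_solutions_ge[OF b(1) ab(1)] by (intro divide_right_mono) auto
  moreover have "real (card ?E') / real b \<ge> (real Y / real b' - 1) / real b"
    using card_solutions_ge[OF b(2) ab(2)] by (intro divide_right_mono) auto
  moreover have "1 / real b \<le> 1" "1 / real b' \<le> 1" using b by auto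
  moreover have "(real Y / real b - 1) / real b' = real Y / (real b * real b') - 1 / real b'"
    "(real Y / real b' - 1) / real b = real Y / (real b * real b') - 1 / real b"
    by (simp_all add: diff_divide_distrib mult.commute)
  ultimately have le: "(\<Sum>k\<in>{1..Y}. (of_bool (k \<in> ?E) - 1 / real b) * (of_bool (k \<in> ?E') - 1 / real b'))
     \<le> real (card (?E \<inter> ?E')) - real Y / (real b * real b') + 2"
    unfolding eq by linarith
  have Ynn: "real Y / (real b * real b') \<ge> 0" by simp
  have int: "real (card (?E \<inter> ?E')) \<le> real Y * real (gcd b b') / (real b * real b') + 1"
    by (rule card_solutions_Int_le[OF b ab])
  show ?thesis
  proof (cases "gcd b b' > 1")
    case False
    then have "gcd b b' = 1" using b by (metis gcd_eq_0_iff less_one linorder_neqE_nat not_one_le_zero)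
    then show ?thesis using le int by simp
  next
    case True
    show ?thesis
    proof (cases "[a = a'] (mod gcd b b')")
      case True
      then have "of_bool (gcd b b' > 1 \<and> [a = a'] (mod gcd b b')) = (1::real)"
        using \<open>gcd b b' > 1\<close> by simp
      then show ?thesis using le int Ynn by (simp only: mult_1_left)
    next
      case False
      have "is_unit s" using s by simp
      then have "coprime s (int (gcd b b'))" by (rule is_unit_left_imp_coprime)
      then have "?E \<inter> ?E' = {}" using solutions_common_gcd[OF ab] False by blast
      then have "real (card (?E \<inter> ?E')) = 0" by simp
      moreover have "of_bool (gcd b b' > 1 \<and> [a = a'] (mod gcd b b')) = (0::real)"
        using False by simp
      ultimately show ?thesis using le Ynn by (simp only: mult_zero_left)
    qed
  qed
qed


section \<open>A dispersion estimate\<close>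

text \<open>Replacing \<open>gcd b b'\<close> by the sum of all common divisors separates the variables; each divisor \<open>d\<close> then
contributes \<open>d\<close> times the square of a harmonic sum over multiples of \<open>d\<close>.\<close>

lemma sum_gcd_div_le:
  fixes B :: "nat set"
  assumes B: "B \<subseteq> {1..Q}" and Q: "Q \<ge> 1"
  shows "(\<Sum>b\<in>B. \<Sum>b'\<in>B. real (gcd b b') / (real b * real b')) \<le> (1 + ln (real Q)) ^ 3"
proof -
  have fin: "finite B" using B by (rule finite_subset) simp
  define h where "h = (\<Sum>d\<in>{1..Q}. 1 / real d)"
  have h0: "h \<ge> 0" by (auto simp: h_def intro!: sum_nonneg)
  have h: "h \<le> 1 + ln (real Q)"
    using euler_mascheroni_sequence_decreasing[of 1 Q] Q by (simp add: h_def harm_def inverse_eq_divide)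
  define R where "R = (\<lambda>d. \<Sum>b\<in>B. of_bool (d dvd b) / real b)"
  have R: "0 \<le> R d" "R d \<le> h / real d" if d: "d \<in> {1..Q}" for d
  proof -
    show "0 \<le> R d" by (auto simp: R_def intro!: sum_nonneg)
    have "R d = (\<Sum>b\<in>{b\<in>B. d dvd b}. 1 / real b)"
      unfolding R_def by (rule sum.mono_neutral_cong_right) (auto simp: fin)
    also have "\<dots> \<le> (\<Sum>b\<in>(\<lambda>c. d * c) ` {1..Q}. 1 / real b)"
    proof (rule sum_mono2)
      show "{b \<in> B. d dvd b} \<subseteq> (\<lambda>c. d * c) ` {1..Q}"
      proof
        fix b assume b: "b \<in> {b \<in> B. d dvd b}"
        then obtain c where c: "b = d * c" by auto
        have bQ: "1 \<le> b" "b \<le> Q" using b B by auto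
        have "c \<le> d * c" using d by simp
        then have "c \<le> Q" using bQ c by linarith
        moreover have "c \<ge> 1" using bQ c by (cases c) auto
        ultimately show "b \<in> (\<lambda>c. d * c) ` {1..Q}" using c by auto
      qed
    qed auto
    also have "\<dots> = (\<Sum>c\<in>{1..Q}. 1 / real (d * c))"
      using d by (subst sum.reindex) (auto simp: inj_on_def)
    also have "\<dots> = h / real d" by (simp add: h_def sum_divide_distrib mult.commute)
    finally show "R d \<le> h / real d" .
  qed
  have "(\<Sum>b\<in>B. \<Sum>b'\<in>B. real (gcd b b') / (real b * real b'))
     \<le> (\<Sum>b\<in>B. \<Sum>b'\<in>B. \<Sum>d\<in>{1..Q}. real d * (of_bool (d dvd b) / real b) * (of_bool (d dvd b') / real b'))"
  proof (intro sum_mono)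
    fix b b' assume bb: "b \<in> B" "b' \<in> B"
    \<comment> \<open>The gcd is one of the common divisors, so its own term already suffices.\<close>
    let ?g = "gcd b b'"
    let ?t = "\<lambda>d. real d * (of_bool (d dvd b) / real b) * (of_bool (d dvd b') / real b')"
    have b: "1 \<le> b" "b \<le> Q" using bb B by auto
    have "?g \<le> b" "?g > 0" using b by (simp_all add: gcd_le1_nat)
    then have "?g \<in> {1..Q}" using b by (simp only: atLeastAtMost_iff) linarith
    then have "?t ?g \<le> (\<Sum>d\<in>{1..Q}. ?t d)" by (intro member_le_sum) auto
    then show "real ?g / (real b * real b') \<le> (\<Sum>d\<in>{1..Q}. ?t d)" by simp
  qed
  also have "\<dots> = (\<Sum>d\<in>{1..Q}. \<Sum>b\<in>B. \<Sum>b'\<in>B. real d * (of_bool (d dvd b) / real b) * (of_bool (d dvd b') / real b'))"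
    by (subst (2) sum.swap, subst sum.swap) (rule refl)
  also have "\<dots> = (\<Sum>d\<in>{1..Q}. real d * (R d * R d))"
    unfolding R_def by (simp add: sum_product sum_distrib_left mult_ac)
  also have "\<dots> \<le> (\<Sum>d\<in>{1..Q}. real d * (h / real d * (h / real d)))"
    using R h0 by (intro sum_mono mult_left_mono mult_mono) auto
  also have "\<dots> = (\<Sum>d\<in>{1..Q}. h\<^sup>2 * (1 / real d))"
    by (intro sum.cong refl) (auto simp: power2_eq_square)
  also have "\<dots> = h ^ 3"
    unfolding sum_distrib_left[symmetric] h_def[symmetric] by (simp add: power2_eq_square power3_eq_cube)
  also have "\<dots> \<le> (1 + ln (real Q)) ^ 3" using h h0 by (rule power_mono)
  finally show ?thesis .
qed

text \<open>The deviation from its mean of the number of pairs \<open>(a, b)\<close> with \<open>b dvd a * k + s\<close>. The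
condition \<open>k \<le> M div a\<close> says \<open>a * k \<le> M\<close>; it is kept inside the sum so that
products up to \<open>M\<close> are counted exactly although the range of \<open>k\<close> depends on \<open>a\<close>.\<close>

definition discrepancy :: "nat \<Rightarrow> int \<Rightarrow> nat set \<Rightarrow> nat set \<Rightarrow> nat \<Rightarrow> real" where
  "discrepancy M s S B k =
     (\<Sum>a\<in>S. \<Sum>b\<in>B. of_bool (k \<le> M div a) * (of_bool (int b dvd int (a * k) + s) - 1 / real b))"

text \<open>The second moment over all integers \<open>k\<close>. Pairs of coprime moduli contribute only rounding errors, at most
3 for each of the \<open>(A Q)\<^sup>2\<close> quadruples: this is small as long as \<open>Q\<^sup>2\<close> stays below the length
\<open>K\<close>. Moduli with a common factor, necessarily at least \<open>G\<close>, force a congruence between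
\<open>a\<close> and \<open>a'\<close> that only about one pair in \<open>G\<close> satisfies.\<close>

lemma sum_discrepancy_squared_le:
  fixes S B :: "nat set" and G :: real
  assumes S: "S \<subseteq> {1..A}" and B: "B \<subseteq> {1..Q}" and Q: "Q \<ge> 1" and s: "\<bar>s\<bar> = 1"
    and cop: "\<And>a b. a \<in> S \<Longrightarrow> b \<in> B \<Longrightarrow> coprime a b"
    and G: "G > 0" "\<And>b b'. b \<in> B \<Longrightarrow> b' \<in> B \<Longrightarrow> gcd b b' > 1 \<Longrightarrow> real (gcd b b') \<ge> G"
    and K: "\<And>a. a \<in> S \<Longrightarrow> M div a \<le> K"
  shows "(\<Sum>k\<in>{1..K}. (discrepancy M s S B k)\<^sup>2)
    \<le> 3 * (real A * real Q)\<^sup>2 + real K * (1 + ln (real Q)) ^ 3 * (real A * (real A / G + 1))"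
proof -
  have fin: "finite S" "finite B" using S B finite_subset by blast+
  define g where "g = (\<lambda>k (a, b). of_bool (k \<le> M div a) * (of_bool (int b dvd int (a * k) + s) - 1 / real b) :: real)"
  let ?SB = "S \<times> B"
  define W where "W = (\<lambda>b b'. real K * (real (gcd b b') / (real b * real b')))"
  have disc: "discrepancy M s S B k = (\<Sum>x\<in>?SB. g k x)" for k
    unfolding discrepancy_def g_def by (simp add: sum.cartesian_product)
  \<comment> \<open>Expanding the square leads to one covariance for every pair of pairs.\<close>
  have "(\<Sum>k\<in>{1..K}. (discrepancy M s S B k)\<^sup>2) = (\<Sum>k\<in>{1..K}. \<Sum>x\<in>?SB. \<Sum>y\<in>?SB. g k x * g k y)"
    unfolding disc power2_eq_square by (simp add: sum_product)
  also have "\<dots> = (\<Sum>x\<in>?SB. \<Sum>y\<in>?SB. \<Sum>k\<in>{1..K}. g k x * g k y)"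
    by (subst sum.swap, subst (2) sum.swap) (rule refl)
  also have "\<dots> \<le> (\<Sum>x\<in>?SB. \<Sum>y\<in>?SB. 3 + of_bool (gcd (snd x) (snd y) > 1 \<and> [fst x = fst y] (mod gcd (snd x) (snd y))) * W (snd x) (snd y))"
  proof (intro sum_mono)
    fix x y assume xy: "x \<in> ?SB" "y \<in> ?SB"
    obtain a b a' b' where eq: "x = (a, b)" "y = (a', b')" by (metis surj_pair)
    have ab: "a \<in> S" "b \<in> B" "a' \<in> S" "b' \<in> B" using xy eq by auto
    then have pos: "b \<ge> 1" "b' \<ge> 1" using B by auto
    define Y where "Y = min (M div a) (M div a')"
    have YK: "Y \<le> K" using K[OF ab(1)] by (simp add: Y_def)
    have "(\<Sum>k\<in>{1..K}. g k x * g k y) = (\<Sum>k\<in>{1..Y}. (of_bool (k \<in> solutions Y s a b) - 1 / real b) * (of_bool (k \<in> solutions Y s a' b') - 1 / real b'))"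
      using YK by (intro sum.mono_neutral_cong_right) (auto simp: g_def eq Y_def solutions_def)
    also have "\<dots> \<le> 3 + of_bool (gcd b b' > 1 \<and> [a = a'] (mod gcd b b')) * (real Y * real (gcd b b') / (real b * real b'))"
      using ab cop pos s by (intro solutions_covariance_le) auto
    also have "\<dots> \<le> 3 + of_bool (gcd b b' > 1 \<and> [a = a'] (mod gcd b b')) * W b b'"
      using YK unfolding W_def by (intro add_left_mono mult_left_mono) (auto simp: divide_right_mono mult_right_mono)
    finally show "(\<Sum>k\<in>{1..K}. g k x * g k y) \<le> 3 + of_bool (gcd (snd x) (snd y) > 1 \<and> [fst x = fst y] (mod gcd (snd x) (snd y))) * W (snd x) (snd y)"
      by (simp add: eq)
  qed
  also have "\<dots> = 3 * (real (card S) * real (card B))\<^sup>2 +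
     (\<Sum>x\<in>?SB. \<Sum>y\<in>?SB. of_bool (gcd (snd x) (snd y) > 1 \<and> [fst x = fst y] (mod gcd (snd x) (snd y))) * W (snd x) (snd y))"
    by (simp add: sum.distrib card_cartesian_product power2_eq_square mult_ac)
  also have "(\<Sum>x\<in>?SB. \<Sum>y\<in>?SB. of_bool (gcd (snd x) (snd y) > 1 \<and> [fst x = fst y] (mod gcd (snd x) (snd y))) * W (snd x) (snd y))
    = (\<Sum>a\<in>S. \<Sum>b\<in>B. \<Sum>a'\<in>S. \<Sum>b'\<in>B. of_bool (gcd b b' > 1 \<and> [a = a'] (mod gcd b b')) * W b b')"
    by (simp only: sum.cartesian_product' fst_conv snd_conv)
  also have "\<dots> = (\<Sum>b\<in>B. \<Sum>a\<in>S. \<Sum>b'\<in>B. \<Sum>a'\<in>S. of_bool (gcd b b' > 1 \<and> [a = a'] (mod gcd b b')) * W b b')"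
    by (subst sum.swap, subst (3) sum.swap) (rule refl)
  also have "\<dots> = (\<Sum>b\<in>B. \<Sum>b'\<in>B. \<Sum>a\<in>S. \<Sum>a'\<in>S. of_bool (gcd b b' > 1 \<and> [a = a'] (mod gcd b b')) * W b b')"
    by (subst (2) sum.swap) (rule refl)
  also have "\<dots> \<le> (\<Sum>b\<in>B. \<Sum>b'\<in>B. W b b' * (real A * (real A / G + 1)))"
  proof (intro sum_mono)
    fix b b' assume bb: "b \<in> B" "b' \<in> B"
    let ?g = "gcd b b'"
    have W0: "W b b' \<ge> 0" by (simp add: W_def)
    show "(\<Sum>a\<in>S. \<Sum>a'\<in>S. of_bool (?g > 1 \<and> [a = a'] (mod ?g)) * W b b') \<le> W b b' * (real A * (real A / G + 1))"
    proof (cases "?g > 1")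
      case False
      then show ?thesis using W0 G by simp
    next
      case True
      have "(\<Sum>a\<in>S. \<Sum>a'\<in>S. of_bool (?g > 1 \<and> [a = a'] (mod ?g)) * W b b')
         = (\<Sum>a\<in>S. W b b' * real (card {a'\<in>S. [a = a'] (mod ?g)}))"
      proof (rule sum.cong[OF refl])
        fix a assume "a \<in> S"
        have "(\<Sum>a'\<in>S. of_bool (?g > 1 \<and> [a = a'] (mod ?g)) * W b b') = (\<Sum>a'\<in>S. of_bool ([a = a'] (mod ?g))) * W b b'"
          using True by (simp add: sum_distrib_right)
        also have "(\<Sum>a'\<in>S. of_bool ([a = a'] (mod ?g)) :: real) = real (card {a'\<in>S. [a = a'] (mod ?g)})"
          using fin by (simp add: Int_def)
        finally show "(\<Sum>a'\<in>S. of_bool (?g > 1 \<and> [a = a'] (mod ?g)) * W b b') = W b b' * real (card {a'\<in>S. [a = a'] (mod ?g)})"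
          by (simp add: mult.commute)
      qed
      also have "\<dots> \<le> (\<Sum>a\<in>S. W b b' * (real A / G + 1))"
      proof (intro sum_mono mult_left_mono W0)
        fix a assume "a \<in> S"
        have "real (card {a'\<in>S. [a = a'] (mod ?g)}) \<le> real A / real ?g + 1"
          using True S by (intro card_congruent_le) (auto intro: cong_trans cong_sym)
        also have "real A / real ?g \<le> real A / G"
          using G(1) G(2)[OF bb True] True by (intro divide_left_mono mult_pos_pos) auto
        finally show "real (card {a'\<in>S. [a = a'] (mod ?g)}) \<le> real A / G + 1" by simp
      qed
      also have "\<dots> = W b b' * (real (card S) * (real A / G + 1))" by simp
      also have "real (card S) \<le> real A" using card_mono[OF _ S] by simp
      finally show ?thesis using W0 G by (simp add: mult_left_mono mult_right_mono)
    qed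
  qed
  also have "\<dots> = real K * (\<Sum>b\<in>B. \<Sum>b'\<in>B. real (gcd b b') / (real b * real b')) * (real A * (real A / G + 1))"
    unfolding W_def by (simp add: sum_distrib_left sum_distrib_right)
  also have "\<dots> \<le> real K * (1 + ln (real Q)) ^ 3 * (real A * (real A / G + 1))"
    using sum_gcd_div_le[OF B Q] G by (intro mult_right_mono mult_left_mono) auto
  also have "3 * (real (card S) * real (card B))\<^sup>2 \<le> 3 * (real A * real Q)\<^sup>2"
    using card_mono[OF _ S] card_mono[OF _ B] by (intro mult_left_mono power_mono mult_mono) auto
  finally show ?thesis by simp
qed


lemma sum_multiples_le:
  "(\<Sum>k\<in>{1..Y}. of_bool (d dvd k) :: real) \<le> real Y / real d" if "d \<ge> 1"
proof -
  have "(\<Sum>k\<in>{1..Y}. of_bool (d dvd k) :: real) = real (card {k\<in>{1..Y}. d dvd k})"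
    by (simp add: Int_def)
  also have "card {k\<in>{1..Y}. d dvd k} = Y div d" using that by (intro card_multiples) simp
  also have "real (Y div d) \<le> real Y / real d" by (rule of_nat_div_le_of_nat)
  finally show ?thesis .
qed

text \<open>Products \<open>m = a * k\<close>, in which \<open>k\<close> has a divisor in \<open>E\<close>, are on average over
\<open>a\<close> and \<open>b\<close> not more frequent in the class \<open>-s\<close> modulo \<open>b\<close> than expected, whatever \<open>E\<close> is. Indeed Cauchy's inequality replaces the weight of \<open>k\<close> (the number of its divisors in
\<open>E\<close>, at most \<open>c\<close>) by all integers up to \<open>K\<close>, where the second moment above is available; the variable \<open>a\<close> alone does the averaging.\<close>

lemma bilinear_count_le:
  fixes S E B :: "nat set" and G V :: real
  assumes S: "S \<subseteq> {1..A}" and E: "finite E" "0 \<notin> E" and B: "B \<subseteq> {1..Q}" and Q: "Q \<ge> 1" and s: "\<bar>s\<bar> = 1"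
    and cop: "\<And>a b. a \<in> S \<Longrightarrow> b \<in> B \<Longrightarrow> coprime a b"
    and G: "G > 0" "\<And>b b'. b \<in> B \<Longrightarrow> b' \<in> B \<Longrightarrow> gcd b b' > 1 \<Longrightarrow> real (gcd b b') \<ge> G"
    and K: "\<And>a. a \<in> S \<Longrightarrow> M div a \<le> K"
    and c: "\<And>k. k \<in> {1..K} \<Longrightarrow> card {e\<in>E. e dvd k} \<le> c"
    and V: "V \<ge> 3 * (real A * real Q)\<^sup>2 + real K * (1 + ln (real Q)) ^ 3 * (real A * (real A / G + 1))"
  shows "(\<Sum>a\<in>S. \<Sum>e\<in>E. \<Sum>b\<in>B. real (card {m\<in>{1..M}. a * e dvd m \<and> int b dvd int m + s}))
    \<le> real M * (\<Sum>a\<in>S. 1 / real a) * (\<Sum>e\<in>E. 1 / real e) * (\<Sum>b\<in>B. 1 / real b)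
      + real c * sqrt (real K * V)"
proof -
  have fin: "finite S" "finite B" using S B finite_subset by blast+
  define w where "w = (\<lambda>k. \<Sum>e\<in>E. of_bool (e dvd k) :: real)"
  have w: "0 \<le> w k" "k \<in> {1..K} \<Longrightarrow> w k \<le> real c" for k
  proof -
    have "w k = real (card {e\<in>E. e dvd k})" using E by (simp add: w_def Int_def)
    then show "0 \<le> w k" "k \<in> {1..K} \<Longrightarrow> w k \<le> real c" using c by auto
  qed
  define t where "t = (\<lambda>a k. of_bool (k \<le> M div a) :: real)"
  have prodSE: "(\<Sum>a\<in>S. \<Sum>e\<in>E. u e * x a) = (\<Sum>e\<in>E. u e) * (\<Sum>a\<in>S. x a)" for u x :: "nat \<Rightarrow> real"
    by (subst sum.swap) (simp add: sum_product)
  \<comment> \<open>Dividing out \<open>a\<close> turns the count into a sum over \<open>k\<close>.\<close>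
  have count: "real (card {m\<in>{1..M}. a * e dvd m \<and> int b dvd int m + s})
      = (\<Sum>k\<in>{1..K}. of_bool (e dvd k) * (t a k * of_bool (int b dvd int (a * k) + s)))"
    if a: "a \<in> S" for a e b
  proof -
    have a0: "a > 0" using a S by auto
    have "{m\<in>{1..M}. a * e dvd m \<and> int b dvd int m + s}
        = (\<lambda>k. a * k) ` {k\<in>{1..K}. k \<le> M div a \<and> e dvd k \<and> int b dvd int (a * k) + s}" (is "?X = _ ` ?Y")
    proof (intro equalityI subsetI)
      fix m assume m: "m \<in> ?X"
      then have "a dvd m" by (auto intro: dvd_mult_left)
      then obtain k where k: "m = a * k" by auto
      have "k \<ge> 1" using m k by (cases k) auto
      moreover have "k \<le> M div a" using m k a0 by (simp add: less_eq_div_iff_mult_less_eq mult.commute)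
      moreover have "e dvd k" using m k a0 by simp
      moreover have "int b dvd int (a * k) + s" using m k by blast
      ultimately show "m \<in> (\<lambda>k. a * k) ` ?Y" using k K[OF a] by auto
    next
      fix m assume "m \<in> (\<lambda>k. a * k) ` ?Y"
      then show "m \<in> ?X"
        using a0 by (auto simp: less_eq_div_iff_mult_less_eq mult.commute Suc_le_eq)
    qed
    moreover have "inj_on (\<lambda>k. a * k) ?Y" using a0 by (auto simp: inj_on_def)
    ultimately have "card ?X = card ?Y" by (simp add: card_image)
    also have "real \<dots> = (\<Sum>k\<in>{1..K}. of_bool (k \<le> M div a \<and> e dvd k \<and> int b dvd int (a * k) + s))"
      by (simp add: Int_def)
    also have "\<dots> = (\<Sum>k\<in>{1..K}. of_bool (e dvd k) * (t a k * of_bool (int b dvd int (a * k) + s)))"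
      by (intro sum.cong refl) (auto simp: t_def)
    finally show ?thesis .
  qed
  have "(\<Sum>a\<in>S. \<Sum>e\<in>E. \<Sum>b\<in>B. real (card {m\<in>{1..M}. a * e dvd m \<and> int b dvd int m + s}))
    = (\<Sum>a\<in>S. \<Sum>e\<in>E. \<Sum>b\<in>B. \<Sum>k\<in>{1..K}. of_bool (e dvd k) * (t a k * of_bool (int b dvd int (a * k) + s)))"
    by (intro sum.cong refl count)
  also have "\<dots> = (\<Sum>a\<in>S. \<Sum>e\<in>E. \<Sum>k\<in>{1..K}. \<Sum>b\<in>B. of_bool (e dvd k) * (t a k * of_bool (int b dvd int (a * k) + s)))"
    by (intro sum.cong refl sum.swap)
  also have "\<dots> = (\<Sum>a\<in>S. \<Sum>k\<in>{1..K}. \<Sum>e\<in>E. \<Sum>b\<in>B. of_bool (e dvd k) * (t a k * of_bool (int b dvd int (a * k) + s)))"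
    by (intro sum.cong refl sum.swap)
  also have "\<dots> = (\<Sum>k\<in>{1..K}. \<Sum>a\<in>S. \<Sum>e\<in>E. \<Sum>b\<in>B. of_bool (e dvd k) * (t a k * of_bool (int b dvd int (a * k) + s)))"
    by (rule sum.swap)
  also have "\<dots> = (\<Sum>k\<in>{1..K}. w k * (\<Sum>a\<in>S. \<Sum>b\<in>B. t a k * of_bool (int b dvd int (a * k) + s)))"
    unfolding w_def by (simp only: sum_distrib_left[symmetric] prodSE)
  \<comment> \<open>Split into the deviation from the mean and the mean itself.\<close>
  also have "\<dots> = (\<Sum>k\<in>{1..K}. w k * discrepancy M s S B k + w k * (\<Sum>a\<in>S. \<Sum>b\<in>B. t a k / real b))"
    unfolding discrepancy_def t_def
    by (intro sum.cong refl) (simp add: algebra_simps sum.distrib sum_subtractf)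
  also have "\<dots> = (\<Sum>k\<in>{1..K}. w k * discrepancy M s S B k) + (\<Sum>k\<in>{1..K}. w k * (\<Sum>a\<in>S. \<Sum>b\<in>B. t a k / real b))"
    by (rule sum.distrib)
  also have "(\<Sum>k\<in>{1..K}. w k * (\<Sum>a\<in>S. \<Sum>b\<in>B. t a k / real b))
      = (\<Sum>k\<in>{1..K}. \<Sum>a\<in>S. \<Sum>e\<in>E. of_bool (e dvd k) * t a k * (\<Sum>b\<in>B. 1 / real b))"
  proof -
    have "(\<Sum>b\<in>B. t a k / real b) = t a k * (\<Sum>b\<in>B. 1 / real b)" for a k
      by (simp add: sum_distrib_left)
    then show ?thesis unfolding w_def by (simp only: mult.assoc prodSE)
  qed
  also have "\<dots> = (\<Sum>a\<in>S. \<Sum>k\<in>{1..K}. \<Sum>e\<in>E. of_bool (e dvd k) * t a k * (\<Sum>b\<in>B. 1 / real b))"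
    by (rule sum.swap)
  also have "\<dots> = (\<Sum>a\<in>S. \<Sum>e\<in>E. \<Sum>k\<in>{1..K}. of_bool (e dvd k) * t a k * (\<Sum>b\<in>B. 1 / real b))"
    by (intro sum.cong refl sum.swap)
  also have "\<dots> \<le> (\<Sum>a\<in>S. \<Sum>e\<in>E. real M / (real a * real e) * (\<Sum>b\<in>B. 1 / real b))"
  proof (intro sum_mono)
    fix a e assume ae: "a \<in> S" "e \<in> E"
    then have e: "e \<ge> 1" using E by (cases e) auto
    have "(\<Sum>k\<in>{1..K}. of_bool (e dvd k) * t a k) = (\<Sum>k\<in>{1..M div a}. of_bool (e dvd k))"
      using K[OF ae(1)] by (intro sum.mono_neutral_cong_right) (auto simp: t_def)
    also have "\<dots> \<le> real (M div a) / real e" by (rule sum_multiples_le[OF e])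
    also have "\<dots> \<le> (real M / real a) / real e" by (intro divide_right_mono of_nat_div_le_of_nat) simp
    finally have "(\<Sum>k\<in>{1..K}. of_bool (e dvd k) * t a k) \<le> real M / (real a * real e)" by simp
    then show "(\<Sum>k\<in>{1..K}. of_bool (e dvd k) * t a k * (\<Sum>b\<in>B. 1 / real b)) \<le> real M / (real a * real e) * (\<Sum>b\<in>B. 1 / real b)"
      unfolding sum_distrib_right[symmetric] by (rule mult_right_mono) (auto intro!: sum_nonneg)
  qed
  also have "\<dots> = real M * (\<Sum>a\<in>S. 1 / real a) * (\<Sum>e\<in>E. 1 / real e) * (\<Sum>b\<in>B. 1 / real b)"
    by (simp add: sum_distrib_left sum_distrib_right sum_product mult_ac)
  also have "(\<Sum>k\<in>{1..K}. w k * discrepancy M s S B k) \<le> real c * sqrt (real K * V)"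
  proof -
    have "(\<Sum>k\<in>{1..K}. w k * discrepancy M s S B k) \<le> (\<Sum>k\<in>{1..K}. real c * \<bar>discrepancy M s S B k\<bar>)"
    proof (rule sum_mono)
      fix k assume k: "k \<in> {1..K}"
      have "w k * discrepancy M s S B k \<le> w k * \<bar>discrepancy M s S B k\<bar>" using w by (intro mult_left_mono) auto
      also have "\<dots> \<le> real c * \<bar>discrepancy M s S B k\<bar>" using w(2)[OF k] by (intro mult_right_mono) auto
      finally show "w k * discrepancy M s S B k \<le> real c * \<bar>discrepancy M s S B k\<bar>" .
    qed
    also have "\<dots> = real c * (\<Sum>k\<in>{1..K}. 1 * \<bar>discrepancy M s S B k\<bar>)" by (simp add: sum_distrib_left)
    also have "(\<Sum>k\<in>{1..K}. 1 * \<bar>discrepancy M s S B k\<bar>) \<le> sqrt (real K * V)"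
    proof (rule real_le_rsqrt)
      have "(\<Sum>k\<in>{1..K}. 1 * \<bar>discrepancy M s S B k\<bar>)\<^sup>2 \<le> (\<Sum>k\<in>{1..K}. 1\<^sup>2) * (\<Sum>k\<in>{1..K}. \<bar>discrepancy M s S B k\<bar>\<^sup>2)"
        by (rule Cauchy_Schwarz_ineq_sum)
      also have "\<dots> = real K * (\<Sum>k\<in>{1..K}. (discrepancy M s S B k)\<^sup>2)" by simp
      also have "\<dots> \<le> real K * V"
        using sum_discrepancy_squared_le[OF S B Q s cop G K] V by (intro mult_left_mono) auto
      finally show "(\<Sum>k\<in>{1..K}. 1 * \<bar>discrepancy M s S B k\<bar>)\<^sup>2 \<le> real K * V" .
    qed
    finally show ?thesis by (simp add: mult_left_mono)
  qed
  finally show ?thesis by simp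
qed

section \<open>Products of two primes\<close>

text \<open>The product of the distinct prime divisors exceeding \<open>z\<close> divides \<open>k\<close>, which leaves room for at most \<open>j\<close> of them.\<close>

lemma card_large_prime_divisors_le:
  fixes k :: nat and z :: real
  assumes "k \<ge> 1" "z \<ge> 1" "real k < z ^ Suc j"
  shows "finite {p. prime p \<and> p dvd k \<and> z < real p}" "card {p. prime p \<and> p dvd k \<and> z < real p} \<le> j"
proof -
  let ?D = "{p. prime p \<and> p dvd k \<and> z < real p}"
  show fin: "finite ?D" using assms(1) by (intro finite_subset[OF _ finite_divisors_nat[of k]]) auto
  have "z ^ card ?D = (\<Prod>p\<in>?D. z)" by simp
  also have "\<dots> \<le> (\<Prod>p\<in>?D. real p)" using assms(2) by (intro prod_mono) auto
  also have "\<dots> = real (\<Prod>?D)" by simp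
  also have "\<Prod>?D dvd k" using fin by (intro prod_primes_dvd) auto
  then have "real (\<Prod>?D) \<le> real k" using assms(1) by (intro of_nat_mono dvd_imp_le) auto
  finally have "z ^ card ?D < z ^ Suc j" using assms(3) by linarith
  then show "card ?D \<le> j" using power_increasing[of "Suc j" "card ?D" z] assms(2) by fastforce
qed

definition products :: "nat set \<Rightarrow> nat set \<Rightarrow> nat set" where
  "products P T = (\<lambda>(p, t). p * t) ` (P \<times> T)"

lemma finite_products [intro]: "finite P \<Longrightarrow> finite T \<Longrightarrow> finite (products P T)"
  by (simp add: products_def)

text \<open>Since the primes in \<open>P\<close> are smaller than those in \<open>T\<close>, unique factorization recovers both factors from the product.\<close>

lemma sum_products:
  assumes "\<And>p. p \<in> P \<Longrightarrow> prime p" "\<And>t. t \<in> T \<Longrightarrow> prime t" "\<And>p t. p \<in> P \<Longrightarrow> t \<in> T \<Longrightarrow> p < t"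
  shows "(\<Sum>b\<in>products P T. f b) = (\<Sum>p\<in>P. \<Sum>t\<in>T. f (p * t))"
proof -
  have "inj_on (\<lambda>(p, t). p * t) (P \<times> T)"
  proof (rule inj_onI, clarify)
    fix p t p' t' assume h: "p \<in> P" "t \<in> T" "p' \<in> P" "t' \<in> T" "p * t = p' * t'"
    have "prime p" "prime p'" "prime t'" using assms h by auto
    have "p dvd p' * t'" using h(5)[symmetric] by simp
    then have "p = p' \<or> p = t'"
      using \<open>prime p\<close> \<open>prime p'\<close> \<open>prime t'\<close> by (metis prime_dvd_mult_iff primes_dvd_imp_eq)
    moreover have False if "p = t'"
    proof -
      have "t = p'" using h(5) that prime_gt_0_nat[OF \<open>prime p\<close>] by (simp add: mult.commute)
      then show False using assms(3)[of p t] assms(3)[of p' t'] h that by simp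
    qed
    ultimately have "p = p'" by blast
    then show "p = p' \<and> t = t'" using h(5) prime_gt_0_nat[OF \<open>prime p\<close>] by simp
  qed
  then show ?thesis
    unfolding products_def by (subst sum.reindex) (simp_all add: sum.cartesian_product case_prod_unfold)
qed

lemma sum_inverse_products:
  assumes "\<And>p. p \<in> P \<Longrightarrow> prime p" "\<And>t. t \<in> T \<Longrightarrow> prime t" "\<And>p t. p \<in> P \<Longrightarrow> t \<in> T \<Longrightarrow> p < t"
  shows "(\<Sum>b\<in>products P T. 1 / real b) = (\<Sum>p\<in>P. 1 / real p) * (\<Sum>t\<in>T. 1 / real t)"
  by (subst sum_products[OF assms]) (auto simp: sum_product)

lemma card_products_dividing_le:
  fixes k :: nat and z :: real
  assumes "k \<ge> 1" "z \<ge> 1" "real k < z ^ Suc j"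
    and "\<And>p. p \<in> P \<union> T \<Longrightarrow> prime p \<and> z < real p"
  shows "card {e\<in>products P T. e dvd k} \<le> j * j"
proof -
  let ?D = "{p. prime p \<and> p dvd k \<and> z < real p}"
  note D = card_large_prime_divisors_le[OF assms(1-3)]
  have "{e\<in>products P T. e dvd k} \<subseteq> (\<lambda>(p, t). p * t) ` (?D \<times> ?D)"
    using assms(4) by (auto simp: products_def image_iff dest: dvd_mult_left dvd_mult_right) 
  then have "card {e\<in>products P T. e dvd k} \<le> card ((\<lambda>(p, t). p * t) ` (?D \<times> ?D))"
    using D by (intro card_mono) auto
  also have "\<dots> \<le> card (?D \<times> ?D)" using D by (intro card_image_le) auto
  also have "\<dots> \<le> j * j" using D by (simp add: card_cartesian_product mult_le_mono)
  finally show ?thesis .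
qed

lemma gcd_products_gt_1_ge:
  fixes z :: real
  assumes "\<And>p. p \<in> P \<union> T \<Longrightarrow> prime p \<and> z < real p" "b \<in> products P T" "gcd b b' > 1"
  shows "real (gcd b b') \<ge> z"
proof -
  obtain r where r: "prime r" "r dvd gcd b b'" using assms(3) prime_factor_nat[of "gcd b b'"] by auto
  obtain p t where pt: "p \<in> P" "t \<in> T" "b = p * t" using assms(2) by (auto simp: products_def)
  have "r dvd p * t" using r pt by auto
  then have "r = p \<or> r = t" using r(1) assms(1)[of p] assms(1)[of t] pt
    by (metis UnI1 UnI2 prime_dvd_mult_iff primes_dvd_imp_eq)
  then have "z < real r" using assms(1) pt by auto
  also have "real r \<le> real (gcd b b')" using r assms(3) by (intro of_nat_mono dvd_imp_le) auto
  finally show ?thesis by simp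
qed

lemma coprime_products:
  assumes "prime p" "b \<in> products P T" "\<And>q. q \<in> P \<union> T \<Longrightarrow> prime q \<and> q \<noteq> p"
  shows "coprime p b"
proof -
  obtain q t where qt: "q \<in> P" "t \<in> T" "b = q * t" using assms(2) by (auto simp: products_def)
  then have "coprime p q" "coprime p t" using assms(1,3) by (auto intro!: primes_coprime)
  then show ?thesis using qt by simp
qed

section \<open>Integers with a large prime cofactor\<close>

text \<open>The error term of the bilinear estimate, for smoothing primes up to \<open>x\<^sup>0\<^sup>.\<^sup>0\<^sup>7\<^sup>2\<close>,
moduli up to \<open>x\<^sup>0\<^sup>.\<^sup>4\<^sup>5\<^sup>3\<close> with prime factors above \<open>x\<^sup>0\<^sup>.\<^sup>0\<^sup>7\<close>, cofactors \<open>k\<close> up to \<open>2 x\<^sup>0\<^sup>.\<^sup>9\<^sup>3\<close>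
and at most 4 representations. It has order \<open>x\<^sup>0\<^sup>.\<^sup>9\<^sup>9\<close>.\<close>

definition dispersion_error :: "real \<Rightarrow> real" where
  "dispersion_error x = 4 * sqrt (2 * x powr (93/100) *
     (3 * (x powr (72/1000) * x powr (453/1000))\<^sup>2 +
      2 * x powr (93/100) * (1 + ln (x powr (453/1000))) ^ 3 *
        (x powr (72/1000) * (x powr (72/1000) / x powr (7/100) + 1))))"

text \<open>The bilinear estimate with the primes in \<open>S\<close> for the averaging and with \<open>E\<close> consisting of the products of a prime
from \<open>T\<close> and a further large prime. The sign \<open>s\<close> and the free
sets allow one statement to serve both members of a pair of consecutive integers.\<close>

lemma large_cofactor_count_le:
  fixes N :: nat and z w :: real
  defines "X \<equiv> real N"
  assumes N: "N \<ge> 1" "2 * X powr (93/100) < (X powr (379/1000)) ^ 3" and M: "M \<le> N + 1" and s: "\<bar>s\<bar> = 1"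
    and S: "S \<subseteq> primes_between (X powr (7/100)) (X powr (72/1000))"
    and T: "T \<subseteq> primes_between (X powr (379/1000)) z"
    and P: "P \<subseteq> primes_between (X powr (7/100)) (X powr (72/1000))" "S \<inter> P = {}"
    and U: "U \<subseteq> primes_between (X powr (379/1000)) (X powr (381/1000))"
    and z: "X powr (379/1000) \<le> z"
  shows "(\<Sum>a\<in>S. \<Sum>e\<in>products T (primes_between z w). \<Sum>b\<in>products P U. real (card {m\<in>{1..M}. a * e dvd m \<and> int b dvd int m + s}))
    \<le> real M * (\<Sum>p\<in>S. 1 / real p) * ((\<Sum>p\<in>T. 1 / real p) * (\<Sum>p\<in>primes_between z w. 1 / real p)) *
        ((\<Sum>p\<in>P. 1 / real p) * (\<Sum>p\<in>U. 1 / real p)) + dispersion_error X"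
proof -
  have X: "X \<ge> 1" using N by (simp add: X_def)
  have mono: "X powr u \<le> X powr v" if "u \<le> v" for u v using X that by (intro powr_mono) auto
  have ge1: "X powr u \<ge> 1" if "u \<ge> 0" for u using X that by (rule ge_one_powr_ge_zero)
  define R where "R = primes_between z w"
  define A where "A = nat \<lfloor>X powr (72/1000)\<rfloor>"
  define Q where "Q = nat \<lfloor>X powr (453/1000)\<rfloor>"
  define K where "K = nat \<lfloor>2 * X powr (93/100)\<rfloor>"
  have A: "real A \<le> X powr (72/1000)" by (simp add: A_def)
  have Q: "real Q \<le> X powr (453/1000)" "Q \<ge> 1" using ge1[of "453/1000"] by (auto simp: Q_def le_nat_floor)
  have K: "real K \<le> 2 * X powr (93/100)" by (simp add: K_def)
  have fin: "finite S" "finite T" "finite R" "finite P" "finite U"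
    using S T P U finite_primes_between finite_subset unfolding R_def by blast+
  have pS: "prime p \<and> X powr (7/100) < real p \<and> real p \<le> X powr (72/1000)" if "p \<in> S \<union> P" for p
    using that S P by (auto simp: primes_between_def)
  have pT: "prime p \<and> X powr (379/1000) < real p \<and> real p \<le> z" if "p \<in> T" for p
    using that T by (auto simp: primes_between_def)
  have pR: "prime p \<and> z < real p" if "p \<in> R" for p
    using that by (auto simp: R_def primes_between_def)
  have pU: "prime p \<and> X powr (379/1000) < real p \<and> real p \<le> X powr (381/1000)" if "p \<in> U" for p
    using that U by (auto simp: primes_between_def)
  have TR: "p < q" if "p \<in> T" "q \<in> R" for p q
    using pT[OF that(1)] pR[OF that(2)] by linarith
  have PU: "p < q" if "p \<in> P" "q \<in> U" for p q
    using pS[of p] pU[OF that(2)] that mono[of "72/1000" "379/1000"] by auto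
  have PU7: "prime p \<and> X powr (7/100) < real p" if "p \<in> P \<union> U" for p
    using that pS[of p] pU[of p] mono[of "7/100" "379/1000"] by auto
  define V where "V = 3 * (X powr (72/1000) * X powr (453/1000))\<^sup>2 +
      2 * X powr (93/100) * (1 + ln (X powr (453/1000))) ^ 3 *
        (X powr (72/1000) * (X powr (72/1000) / X powr (7/100) + 1))"
  have lnQ: "0 \<le> ln (real Q)" using Q by simp
  have lnQ': "ln (real Q) \<le> ln (X powr (453/1000))"
    by (subst ln_le_cancel_iff) (use Q X in auto)
  have "(\<Sum>a\<in>S. \<Sum>e\<in>products T R. \<Sum>b\<in>products P U. real (card {m\<in>{1..M}. a * e dvd m \<and> int b dvd int m + s}))
    \<le> real M * (\<Sum>a\<in>S. 1 / real a) * (\<Sum>e\<in>products T R. 1 / real e) * (\<Sum>b\<in>products P U. 1 / real b)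
      + real (2 * 2) * sqrt (real K * V)"
  proof (rule bilinear_count_le[where G = "X powr (7/100)" and A = A and Q = Q])
    show "S \<subseteq> {1..A}"
    proof
      fix a assume "a \<in> S"
      then have "prime a" "real a \<le> X powr (72/1000)" using pS[of a] by auto
      then show "a \<in> {1..A}" using prime_ge_1_nat[of a] by (simp add: A_def le_nat_floor)
    qed
    show "finite (products T R)" using fin by blast
    have "0 \<notin> T" "0 \<notin> R" using pT pR not_prime_0 by blast+
    then show "0 \<notin> products T R" by (auto simp: products_def)
    show "products P U \<subseteq> {1..Q}"
    proof
      fix b assume "b \<in> products P U"
      then obtain p u where pu: "p \<in> P" "u \<in> U" "b = p * u" by (auto simp: products_def)
      have "real b \<le> X powr (72/1000) * X powr (381/1000)"
        unfolding pu(3) of_nat_mult using pS[of p] pU[of u] pu by (intro mult_mono) auto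
      also have "\<dots> = X powr (453/1000)" by (simp add: powr_add[symmetric])
      finally have "b \<le> Q" by (simp add: Q_def le_nat_floor)
      moreover have "b \<ge> 1" using pS[of p] pU[of u] pu prime_gt_0_nat by (auto simp: Suc_le_eq)
      ultimately show "b \<in> {1..Q}" by simp
    qed
    show "1 \<le> Q" by fact
    show "\<bar>s\<bar> = 1" by fact
    show "coprime a b" if "a \<in> S" "b \<in> products P U" for a b
    proof (rule coprime_products[OF _ that(2)])
      show "prime a" using pS that by auto
      fix q assume "q \<in> P \<union> U"
      then show "prime q \<and> q \<noteq> a"
        using P(2) that(1) pS[of a] pS[of q] pU[of q] mono[of "72/1000" "379/1000"] by auto
    qed
    show "X powr (7/100) > 0" using X by simp
    show "real (gcd b b') \<ge> X powr (7/100)" if "b \<in> products P U" "b' \<in> products P U" "gcd b b' > 1" for b b'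
      using PU7 that by (intro gcd_products_gt_1_ge[of P U]) auto
    show "M div a \<le> K" if "a \<in> S" for a
    proof -
      have "real (M div a) \<le> real M / real a" by (rule of_nat_div_le_of_nat)
      also have "\<dots> \<le> 2 * X / X powr (7/100)"
        using pS[of a] that M X by (intro frac_le) (auto simp: X_def)
      also have "\<dots> = 2 * X powr (93/100)"
        using X powr_diff[of X 1 "7/100"] by simp
      finally show ?thesis by (simp add: K_def le_nat_floor)
    qed
    show "card {e \<in> products T R. e dvd k} \<le> 2 * 2" if k: "k \<in> {1..K}" for k
    proof (rule card_products_dividing_le[where z = "X powr (379/1000)"])
      show "1 \<le> k" "1 \<le> X powr (379/1000)" using k ge1 by auto
      have "real k \<le> real K" using k by simp
      also have "\<dots> \<le> 2 * X powr (93/100)" by fact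
      \<comment> \<open>Three primes above \<open>X\<^sup>0\<^sup>.\<^sup>3\<^sup>7\<^sup>9\<close> do not fit into \<open>k\<close>.\<close>
      also have "\<dots> < (X powr (379/1000)) ^ Suc 2" using N(2) by (simp add: eval_nat_numeral)
      finally show "real k < (X powr (379/1000)) ^ Suc 2" .
    qed (use pT pR z in force)
    show "3 * (real A * real Q)\<^sup>2 + real K * (1 + ln (real Q)) ^ 3 * (real A * (real A / X powr (7/100) + 1)) \<le> V"
      unfolding V_def using A Q K lnQ lnQ' X
      by (intro add_mono mult_mono power_mono mult_nonneg_nonneg divide_right_mono) auto
  qed
  also have "(\<Sum>e\<in>products T R. 1 / real e) = (\<Sum>p\<in>T. 1 / real p) * (\<Sum>p\<in>R. 1 / real p)"
    using pT pR TR by (intro sum_inverse_products) auto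
  also have "(\<Sum>b\<in>products P U. 1 / real b) = (\<Sum>p\<in>P. 1 / real p) * (\<Sum>p\<in>U. 1 / real p)"
    using pS pU PU by (intro sum_inverse_products) auto
  also have "real (2 * 2) * sqrt (real K * V) \<le> dispersion_error X"
    unfolding dispersion_error_def V_def[symmetric] using K X
    by (auto intro!: mult_right_mono simp: V_def intro!: add_nonneg_nonneg mult_nonneg_nonneg zero_le_power)
  finally show ?thesis unfolding R_def by simp
qed

section \<open>Consecutive smooth integers in prescribed order\<close>

lemma prime_largest_prime_factor_dvd:
  "n \<ge> 2 \<Longrightarrow> prime (largest_prime_factor n) \<and> largest_prime_factor n dvd n"
proof -
  assume n: "n \<ge> 2"
  obtain p where "prime p" "p dvd n" using prime_factor_nat[of n] n by auto
  then have "prime_factors n \<noteq> {}" using n by (auto simp: prime_factors_dvd)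
  then have "Max (prime_factors n) \<in> prime_factors n" by (intro Max_in) auto
  then show ?thesis using n by (auto simp: largest_prime_factor_def prime_factors_dvd)
qed

lemma prime_le_largest_prime_factor:
  "n > 0 \<Longrightarrow> prime p \<Longrightarrow> p dvd n \<Longrightarrow> p \<le> largest_prime_factor n"
proof -
  assume h: "n > 0" "prime p" "p dvd n"
  then have "n \<ge> 2" using dvd_imp_le[of p n] prime_ge_2_nat[of p] by simp
  then show ?thesis using h by (auto simp: largest_prime_factor_def prime_factors_dvd intro!: Max_ge)
qed

text \<open>A prime divisor \<open>q > v\<close> of \<open>m\<close> would be coprime to \<open>a\<close>, so \<open>a * q\<close> would divide \<open>m\<close>; since \<open>a > y\<close>, this
confines \<open>q\<close> to the interval \<open>(v, x]\<close>, where such primes are excluded.\<close>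

lemma prime_divisor_le_of_no_cofactor:
  fixes v y x :: real
  assumes a: "a \<in> products S T" "\<And>p. p \<in> S \<union> T \<Longrightarrow> prime p \<and> real p \<le> v" "real a > y" "y > 0"
    and m: "m > 0" "real m \<le> x * y" "a dvd m"
    and no: "\<not> (\<exists>q\<in>primes_between v x. a * q dvd m)"
    and q: "prime q" "q dvd m"
  shows "real q \<le> v"
proof (rule ccontr)
  assume qv: "\<not> real q \<le> v"
  have "coprime q a" using a(2) qv by (intro coprime_products[OF q(1) a(1)]) auto
  then have dvd: "a * q dvd m" using m q by (intro divides_mult) (auto simp: coprime_commute)
  have "real a * real q \<le> real m"
    using dvd_imp_le[OF dvd m(1)] by (metis of_nat_le_iff of_nat_mult)
  then have "real q * real a \<le> x * y" using m(2) by (simp add: mult.commute)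
  have "real q * y \<le> real q * real a" using a(3) by (intro mult_left_mono) auto
  then have "real q * y \<le> x * y" using \<open>real q * real a \<le> x * y\<close> by simp
  then have "real q \<le> x" using a(4) by simp
  then have "q \<in> primes_between v x" using q qv by (simp add: primes_between_def)
  then show False using no dvd by blast
qed

lemma card_le_of_bounded:
  fixes y :: real
  assumes "\<And>a. a \<in> S \<Longrightarrow> 1 \<le> a \<and> real a \<le> y" "y \<ge> 0"
  shows "real (card S) \<le> y"
proof -
  have "S \<subseteq> {1..nat \<lfloor>y\<rfloor>}" using assms(1) by (auto simp: le_nat_floor Suc_le_eq)
  then have "card S \<le> nat \<lfloor>y\<rfloor>" using card_mono[of "{1..nat \<lfloor>y\<rfloor>}" S] by simp
  then have "real (card S) \<le> real (nat \<lfloor>y\<rfloor>)" by (rule of_nat_mono)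
  also have "\<dots> \<le> y" using assms(2) by (rule of_nat_floor)
  finally show ?thesis .
qed

text \<open>The neighbour of \<open>m\<close> is written \<open>m + s\<close> with an integer \<open>s\<close>, to be taken as 1 or -1: the two values give the two
orders.\<close>

definition ordered_smooth :: "nat \<Rightarrow> int \<Rightarrow> real \<Rightarrow> nat set" where
  "ordered_smooth N s v = {m\<in>{2..N}. largest_prime_factor m < largest_prime_factor (nat (int m + s)) \<and>
      real (largest_prime_factor (nat (int m + s))) \<le> v}"

text \<open>Start from all triples \<open>(a, b, m)\<close> with \<open>a dvd m\<close> and \<open>b dvd m + s\<close>, and remove those in which
\<open>m div a\<close> or \<open>(m + s) div b\<close> has a large prime factor. In a remaining triple every prime factor of \<open>m\<close> is at most
\<open>X\<^sup>0\<^sup>.\<^sup>3\<^sup>8\<close>, whereas \<open>m + s\<close> has a prime factor from \<open>U\<close>, which is larger, and none above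
\<open>X\<^sup>0\<^sup>.\<^sup>3\<^sup>8\<^sup>1\<close>. Each \<open>m\<close> occurs in boundedly many triples since all the primes involved exceed \<open>X\<^sup>0\<^sup>.\<^sup>0\<^sup>7\<close>.\<close>

lemma ordered_smooth_lower_bound:
  fixes N :: nat
  defines "X \<equiv> real N"
  defines "S \<equiv> primes_between (X powr (70/1000)) (X powr (71/1000))"
    and "P \<equiv> primes_between (X powr (71/1000)) (X powr (72/1000))"
    and "T \<equiv> primes_between (X powr (379/1000)) (X powr (380/1000))"
    and "U \<equiv> primes_between (X powr (380/1000)) (X powr (381/1000))"
    and "R \<equiv> primes_between (X powr (380/1000)) (2 * X powr (551/1000))"
    and "R' \<equiv> primes_between (X powr (381/1000)) (2 * X powr (551/1000))"
  assumes N: "N \<ge> 1" "2 * X powr (93/100) < (X powr (379/1000)) ^ 3"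
    "X + 1 < (X powr (70/1000)) ^ 15"
    and s: "\<bar>s\<bar> = 1"
  shows "(\<Sum>p\<in>S. 1 / real p) * (\<Sum>p\<in>T. 1 / real p) * ((\<Sum>p\<in>P. 1 / real p) * (\<Sum>p\<in>U. 1 / real p)) *
       (X - (X + 1) * ((\<Sum>p\<in>R. 1 / real p) + (\<Sum>p\<in>R'. 1 / real p)))
     - 2 * X powr (904/1000) - 2 * dispersion_error X
   \<le> 14 ^ 4 * real (card (ordered_smooth N s (X powr (381/1000))))"
proof -
  have X: "X \<ge> 1" using N by (simp add: X_def)
  have mono: "X powr u \<le> X powr v" if "u \<le> v" for u v using X that by (intro powr_mono) auto
  have ge1: "X powr u \<ge> 1" if "u \<ge> 0" for u using X that by (rule ge_one_powr_ge_zero)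
  let ?A = "products S T" and ?B = "products P U"
  let ?G = "ordered_smooth N s (X powr (381/1000))"
  let ?h = "\<lambda>m::nat. nat (int m + s)"
  have pS: "prime p \<and> X powr (70/1000) < real p \<and> real p \<le> X powr (71/1000)" if "p \<in> S" for p
    using that by (auto simp: S_def primes_between_def)
  have pP: "prime p \<and> X powr (71/1000) < real p \<and> real p \<le> X powr (72/1000)" if "p \<in> P" for p
    using that by (auto simp: P_def primes_between_def)
  have pT: "prime p \<and> X powr (379/1000) < real p \<and> real p \<le> X powr (380/1000)" if "p \<in> T" for p
    using that by (auto simp: T_def primes_between_def)
  have pU: "prime p \<and> X powr (380/1000) < real p \<and> real p \<le> X powr (381/1000)" if "p \<in> U" for p
    using that by (auto simp: U_def primes_between_def)
  note ms = mono[of "70/1000" "71/1000"] mono[of "71/1000" "72/1000"] mono[of "71/1000" "380/1000"]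
     mono[of "72/1000" "381/1000"] mono[of "70/1000" "380/1000"] mono[of "70/1000" "379/1000"] mono[of "72/1000" "379/1000"]
     mono[of "379/1000" "380/1000"] mono[of "380/1000" "381/1000"] mono[of "71/1000" "379/1000"]
  have ST: "prime p \<and> X powr (70/1000) < real p \<and> real p \<le> X powr (380/1000)" if "p \<in> S \<union> T" for p
    using that pS[of p] pT[of p] ms by auto
  have PU: "prime p \<and> X powr (70/1000) < real p \<and> real p \<le> X powr (381/1000)" if "p \<in> P \<union> U" for p
    using that pP[of p] pU[of p] ms by auto
  have ltST: "p < t" if "p \<in> S" "t \<in> T" for p t
    using pS[OF that(1)] pT[OF that(2)] ms by auto
  have ltPU: "p < t" if "p \<in> P" "t \<in> U" for p t
    using pP[OF that(1)] pU[OF that(2)] ms by auto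
  have fin: "finite S" "finite T" "finite P" "finite U" "finite R" "finite R'"
    by (auto simp: S_def T_def P_def U_def R_def R'_def)
  have finAB: "finite ?A" "finite ?B" using fin by blast+
  have Abd: "X powr (449/1000) < real a \<and> real a \<le> X powr (451/1000)" if "a \<in> ?A" for a
  proof -
    obtain p t where pt: "p \<in> S" "t \<in> T" "a = p * t" using \<open>a \<in> ?A\<close> by (auto simp: products_def)
    have "X powr (70/1000) * X powr (379/1000) < real p * real t"
      using pS[OF pt(1)] pT[OF pt(2)] X by (intro mult_strict_mono) (auto intro: prime_gt_0_nat)
    moreover have "real p * real t \<le> X powr (71/1000) * X powr (380/1000)"
      using pS[OF pt(1)] pT[OF pt(2)] by (intro mult_mono) auto
    ultimately show ?thesis using pt by (simp add: powr_add[symmetric])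
  qed
  have Bbd: "X powr (449/1000) < real b \<and> real b \<le> X powr (453/1000)" if "b \<in> ?B" for b
  proof -
    obtain p t where pt: "p \<in> P" "t \<in> U" "b = p * t" using \<open>b \<in> ?B\<close> by (auto simp: products_def)
    have "X powr (71/1000) * X powr (380/1000) < real p * real t"
      using pP[OF pt(1)] pU[OF pt(2)] X by (intro mult_strict_mono) (auto intro: prime_gt_0_nat)
    moreover have "real p * real t \<le> X powr (72/1000) * X powr (381/1000)"
      using pP[OF pt(1)] pU[OF pt(2)] by (intro mult_mono) auto
    moreover have "X powr (449/1000) \<le> X powr (451/1000)" by (rule mono) simp
    ultimately show ?thesis using pt by (simp add: powr_add[symmetric])
  qed
  have A1: "a > 1" if "a \<in> ?A" for a using Abd[OF that] ge1[of "449/1000"] by linarith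
  have B1: "b > 1" if "b \<in> ?B" for b using Bbd[OF that] ge1[of "449/1000"] by linarith
  have cop: "coprime a b" if "a \<in> ?A" "b \<in> ?B" for a b
  proof -
    obtain p t where pt: "p \<in> S" "t \<in> T" "a = p * t" using \<open>a \<in> ?A\<close> by (auto simp: products_def)
    note pt_bds = pS[OF pt(1)] pT[OF pt(2)]
    have "prime q \<and> q \<noteq> p \<and> q \<noteq> t" if "q \<in> P \<union> U" for q
      using that
    proof
      assume "q \<in> P"
      then show ?thesis using pP[of q] pt_bds ms by auto
    next
      assume "q \<in> U"
      then show ?thesis using pU[of q] pt_bds ms by auto
    qed
    then have "coprime p b" "coprime t b" using pt_bds
      by (auto intro!: coprime_products[OF _ that(2)])
    then show ?thesis using pt by simp
  qed
  define F where "F = (\<lambda>a b. {m\<in>{1..N}. a dvd m \<and> int b dvd int m + s})"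
  define F1 where "F1 = (\<lambda>a b q. {m\<in>{1..N}. a * q dvd m \<and> int b dvd int m + s})"
  define F2 where "F2 = (\<lambda>a b q. {m\<in>{1..N+1}. b * q dvd m \<and> int a dvd int m + (- s)})"
  define sA where "sA = (\<Sum>p\<in>S. 1 / real p) * (\<Sum>p\<in>T. 1 / real p)"
  define sB where "sB = (\<Sum>p\<in>P. 1 / real p) * (\<Sum>p\<in>U. 1 / real p)"
  define r where "r = (\<Sum>p\<in>R. 1 / real p)"
  define r' where "r' = (\<Sum>p\<in>R'. 1 / real p)"
  have sA: "(\<Sum>a\<in>?A. 1 / real a) = sA" unfolding sA_def
    using pS pT ltST by (intro sum_inverse_products) auto
  have sB: "(\<Sum>b\<in>?B. 1 / real b) = sB" unfolding sB_def
    using pP pU ltPU by (intro sum_inverse_products) auto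
  have lower: "X * sA * sB - 2 * X powr (904/1000) \<le> (\<Sum>a\<in>?A. \<Sum>b\<in>?B. real (card (F a b)))"
  proof -
    have "real (card ?A) \<le> X powr (451/1000)"
      using Abd A1 by (intro card_le_of_bounded) (auto intro: less_imp_le)
    moreover have "real (card ?B) \<le> X powr (453/1000)"
      using Bbd B1 by (intro card_le_of_bounded) (auto intro: less_imp_le)
    ultimately have "real (card ?A) * real (card ?B) \<le> X powr (451/1000) * X powr (453/1000)"
      by (intro mult_mono) auto
    then have cAB: "real (card ?A) * real (card ?B) \<le> X powr (904/1000)" by (simp add: powr_add[symmetric])
    have "(\<Sum>a\<in>?A. \<Sum>b\<in>?B. X * (1 / real a) * (1 / real b) - 2) = X * sA * sB - 2 * (real (card ?A) * real (card ?B))"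
      by (simp add: sum_subtractf sA[symmetric] sB[symmetric] sum_product sum_distrib_left mult_ac)
    moreover have "(\<Sum>a\<in>?A. \<Sum>b\<in>?B. X * (1 / real a) * (1 / real b) - 2) \<le> (\<Sum>a\<in>?A. \<Sum>b\<in>?B. real (card (F a b)))"
    proof (intro sum_mono)
      fix a b assume ab: "a \<in> ?A" "b \<in> ?B"
      have a0: "a > 1" "b > 1" using A1 B1 ab by auto
      have "(\<lambda>k. a * k) ` solutions (N div a) s a b \<subseteq> F a b"
        using a0 by (auto simp: solutions_def F_def less_eq_div_iff_mult_less_eq mult.commute Suc_le_eq)
      moreover have "inj_on (\<lambda>k. a * k) (solutions (N div a) s a b)" using a0 by (auto simp: inj_on_def)
      moreover have "finite (F a b)" by (simp add: F_def)
      ultimately have "card (solutions (N div a) s a b) \<le> card (F a b)" by (metis card_image card_mono)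
      moreover have "real (card (solutions (N div a) s a b)) \<ge> real (N div a) / real b - 1"
        using a0 cop[OF ab] by (intro card_solutions_ge) auto
      moreover have "real (N div a) / real b \<ge> (X / real a - 1) / real b"
        using real_div_le_nat_div_add_1[of a N] a0 by (intro divide_right_mono) (auto simp: X_def)
      moreover have "(X / real a - 1) / real b = X * (1 / real a) * (1 / real b) - 1 / real b"
        by (simp add: diff_divide_distrib)
      moreover have "1 / real b \<le> 1" using a0 by simp
      ultimately show "X * (1 / real a) * (1 / real b) - 2 \<le> real (card (F a b))" by linarith
    qed
    ultimately show ?thesis using cAB by linarith
  qed
  \<comment> \<open>Here \<open>m\<close> itself has a large cofactor: the averaging runs over the primes in \<open>S\<close>, the moduli are the \<open>b\<close>.\<close>
  have bad1: "(\<Sum>a\<in>?A. \<Sum>b\<in>?B. \<Sum>q\<in>R. real (card (F1 a b q))) \<le> X * sA * sB * r + dispersion_error X"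
  proof -
    have prods: "(\<Sum>e\<in>products T R. f e) = (\<Sum>t\<in>T. \<Sum>q\<in>R. f (t * q))" for f :: "nat \<Rightarrow> real"
    proof (rule sum_products)
      fix t q assume tq: "t \<in> T" "q \<in> R"
      have "real t < real q" using pT[OF tq(1)] tq(2) by (simp add: R_def primes_between_def)
      then show "t < q" by simp
    qed (use pT in \<open>auto simp: R_def primes_between_def\<close>)
    have "(\<Sum>a\<in>?A. \<Sum>b\<in>?B. \<Sum>q\<in>R. real (card (F1 a b q)))
      = (\<Sum>p\<in>S. \<Sum>t\<in>T. \<Sum>b\<in>?B. \<Sum>q\<in>R. real (card (F1 (p * t) b q)))"
      using pS pT ltST by (intro sum_products) auto
    also have "\<dots> = (\<Sum>p\<in>S. \<Sum>t\<in>T. \<Sum>q\<in>R. \<Sum>b\<in>?B. real (card (F1 (p * t) b q)))"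
      by (intro sum.cong refl sum.swap)
    also have "\<dots> = (\<Sum>p\<in>S. \<Sum>e\<in>products T R. \<Sum>b\<in>?B. real (card {m\<in>{1..N}. p * e dvd m \<and> int b dvd int m + s}))"
      unfolding F1_def prods by (simp only: mult.assoc)
    also have "\<dots> \<le> real N * (\<Sum>p\<in>S. 1 / real p) * ((\<Sum>p\<in>T. 1 / real p) * r) *
        ((\<Sum>p\<in>P. 1 / real p) * (\<Sum>p\<in>U. 1 / real p)) + dispersion_error (real N)"
      unfolding R_def r_def
    proof (rule large_cofactor_count_le)
      show "P \<subseteq> primes_between (real N powr (7/100)) (real N powr (72/1000))" "S \<subseteq> primes_between (real N powr (7/100)) (real N powr (72/1000))"
        using pS pP ms by (force simp: primes_between_def X_def)+
      show "S \<inter> P = {}" using pS pP by force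
      show "U \<subseteq> primes_between (real N powr (379/1000)) (real N powr (381/1000))"
        using pU ms by (force simp: primes_between_def X_def)
    qed (use N s ms in \<open>auto simp: X_def T_def\<close>)
    finally show ?thesis by (simp add: X_def sA_def sB_def mult_ac)
  qed
  \<comment> \<open>Here the neighbour \<open>m + s\<close>, which may be \<open>N + 1\<close>, has a large cofactor: the roles of \<open>a\<close> and \<open>b\<close> are exchanged and the sign is reversed.\<close>
  have bad2: "(\<Sum>a\<in>?A. \<Sum>b\<in>?B. \<Sum>q\<in>R'. real (card (F2 a b q))) \<le> (X + 1) * sA * sB * r' + dispersion_error X"
  proof -
    have prods: "(\<Sum>e\<in>products U R'. f e) = (\<Sum>t\<in>U. \<Sum>q\<in>R'. f (t * q))" for f :: "nat \<Rightarrow> real"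
    proof (rule sum_products)
      fix t q assume tq: "t \<in> U" "q \<in> R'"
      have "real t < real q" using pU[OF tq(1)] tq(2) by (simp add: R'_def primes_between_def)
      then show "t < q" by simp
    qed (use pU in \<open>auto simp: R'_def primes_between_def\<close>)
    have "(\<Sum>a\<in>?A. \<Sum>b\<in>?B. \<Sum>q\<in>R'. real (card (F2 a b q))) = (\<Sum>b\<in>?B. \<Sum>a\<in>?A. \<Sum>q\<in>R'. real (card (F2 a b q)))"
      by (rule sum.swap)
    also have "\<dots> = (\<Sum>p\<in>P. \<Sum>t\<in>U. \<Sum>a\<in>?A. \<Sum>q\<in>R'. real (card (F2 a (p * t) q)))"
      using pP pU ltPU by (intro sum_products) auto
    also have "\<dots> = (\<Sum>p\<in>P. \<Sum>t\<in>U. \<Sum>q\<in>R'. \<Sum>a\<in>?A. real (card (F2 a (p * t) q)))"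
      by (intro sum.cong refl sum.swap)
    also have "\<dots> = (\<Sum>p\<in>P. \<Sum>e\<in>products U R'. \<Sum>a\<in>?A. real (card {m\<in>{1..N+1}. p * e dvd m \<and> int a dvd int m + (- s)}))"
      unfolding F2_def prods by (simp only: mult.assoc)
    also have "\<dots> \<le> real (N + 1) * (\<Sum>p\<in>P. 1 / real p) * ((\<Sum>p\<in>U. 1 / real p) * r') *
        ((\<Sum>p\<in>S. 1 / real p) * (\<Sum>p\<in>T. 1 / real p)) + dispersion_error (real N)"
      unfolding R'_def r'_def
    proof (rule large_cofactor_count_le)
      show "P \<subseteq> primes_between (real N powr (7/100)) (real N powr (72/1000))" "S \<subseteq> primes_between (real N powr (7/100)) (real N powr (72/1000))"
        using pS pP ms by (force simp: primes_between_def X_def)+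
      show "P \<inter> S = {}" using pS pP by force
      show "T \<subseteq> primes_between (real N powr (379/1000)) (real N powr (381/1000))"
        using pT ms by (force simp: primes_between_def X_def)
      show "U \<subseteq> primes_between (real N powr (379/1000)) (X powr (381/1000))"
        using pU ms by (force simp: primes_between_def X_def)
    qed (use N s ms in \<open>auto simp: X_def\<close>)
    finally show ?thesis by (simp add: X_def sA_def sB_def ac_simps)
  qed
  have h: "int (?h m) = int m + s" if "m \<ge> 1" for m using that s by simp
  \<comment> \<open>A prime \<open>q\<close> with \<open>a * q\<close> at most \<open>2 X\<close> is at most \<open>2 X\<^sup>0\<^sup>.\<^sup>5\<^sup>5\<^sup>1\<close>, as \<open>a\<close> and \<open>b\<close> exceed \<open>X\<^sup>0\<^sup>.\<^sup>4\<^sup>4\<^sup>9\<close>.\<close>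
  have Xy: "2 * X powr (551/1000) * X powr (449/1000) = 2 * X"
    using X by (simp add: mult.assoc powr_add[symmetric])
  have split: "card (F a b) \<le> card {m\<in>?G. a dvd m \<and> b dvd ?h m} + (\<Sum>q\<in>R. card (F1 a b q)) + (\<Sum>q\<in>R'. card (F2 a b q))"
    if ab: "a \<in> ?A" "b \<in> ?B" for a b
  proof -
    let ?H = "{m\<in>{2..N}. \<exists>q\<in>R'. a dvd m \<and> b * q dvd ?h m}"
    have "F a b \<subseteq> {m\<in>?G. a dvd m \<and> b dvd ?h m} \<union> (\<Union>q\<in>R. F1 a b q) \<union> ?H"
    proof
      fix m assume m: "m \<in> F a b"
      then have m1: "m \<ge> 1" "m \<le> N" "a dvd m" by (auto simp: F_def)
      have m2: "m \<ge> 2" using A1[OF ab(1)] dvd_imp_le[OF m1(3)] m1 by linarith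
      have "int b dvd int (?h m)" using m h[OF m1(1)] by (simp add: F_def)
      then have bm: "b dvd ?h m" by (simp only: int_dvd_int_iff)
      have hm: "?h m > 0" "?h m \<le> N + 1" using m2 m1 s by auto
      show "m \<in> {m\<in>?G. a dvd m \<and> b dvd ?h m} \<union> (\<Union>q\<in>R. F1 a b q) \<union> ?H"
      proof (cases "(\<exists>q\<in>R. a * q dvd m) \<or> (\<exists>q\<in>R'. b * q dvd ?h m)")
        case True
        then show ?thesis
        proof
          assume "\<exists>q\<in>R. a * q dvd m"
          then show ?thesis using m by (auto simp: F1_def F_def)
        next
          assume "\<exists>q\<in>R'. b * q dvd ?h m"
          then show ?thesis using m1 m2 by auto
        qed
      next
        case False
        have small: "real q \<le> X powr (380/1000)" if "prime q" "q dvd m" for q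
        proof (rule prime_divisor_le_of_no_cofactor[OF ab(1) _ _ _ _ _ m1(3) _ that])
          show "real m \<le> 2 * X powr (551/1000) * X powr (449/1000)"
            unfolding Xy using m1 by (simp add: X_def)
        qed (use ST Abd[OF ab(1)] X m1 False in \<open>auto simp: R_def\<close>)
        have small': "real q \<le> X powr (381/1000)" if "prime q" "q dvd ?h m" for q
        proof (rule prime_divisor_le_of_no_cofactor[OF ab(2) _ _ _ hm(1) _ bm _ that])
          have "real (?h m) \<le> real (N + 1)" using hm(2) by (rule of_nat_mono)
          then show "real (?h m) \<le> 2 * X powr (551/1000) * X powr (449/1000)"
            unfolding Xy using X by (simp add: X_def)
        qed (use PU Bbd[OF ab(2)] X False in \<open>auto simp: R'_def\<close>)
        obtain p u where pu: "p \<in> P" "u \<in> U" "b = p * u" using ab(2) by (auto simp: products_def)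
        have "u dvd ?h m" using bm pu by (auto intro: dvd_mult_right)
        then have "u \<le> largest_prime_factor (?h m)" using pU[OF pu(2)] hm by (intro prime_le_largest_prime_factor) auto
        moreover have "real (largest_prime_factor m) \<le> X powr (380/1000)"
          using prime_largest_prime_factor_dvd[OF m2] small by blast
        moreover have "X powr (380/1000) < real u" using pU[OF pu(2)] by simp
        ultimately have "largest_prime_factor m < largest_prime_factor (?h m)" by linarith
        moreover have "?h m \<ge> 2" using dvd_imp_le[OF bm hm(1)] B1[OF ab(2)] by linarith
        then have "real (largest_prime_factor (?h m)) \<le> X powr (381/1000)"
          using prime_largest_prime_factor_dvd small' by blast
        ultimately show ?thesis using m2 m1 bm by (simp add: ordered_smooth_def)
      qed
    qed
    moreover have "finite ({m\<in>?G. a dvd m \<and> b dvd ?h m} \<union> (\<Union>q\<in>R. F1 a b q) \<union> ?H)"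
      using fin by (auto simp: ordered_smooth_def F1_def)
    ultimately have "card (F a b) \<le> card ({m\<in>?G. a dvd m \<and> b dvd ?h m} \<union> (\<Union>q\<in>R. F1 a b q) \<union> ?H)"
      by (rule card_mono[rotated])
    also have "\<dots> \<le> card {m\<in>?G. a dvd m \<and> b dvd ?h m} + card (\<Union>q\<in>R. F1 a b q) + card ?H"
      by (meson add_right_mono card_Un_le order_trans)
    also have "card (\<Union>q\<in>R. F1 a b q) \<le> (\<Sum>q\<in>R. card (F1 a b q))" using fin by (intro card_UN_le) auto
    also have "card ?H \<le> card (\<Union>q\<in>R'. F2 a b q)"
    proof (rule card_inj_on_le)
      show "inj_on ?h ?H" using s by (auto simp: inj_on_def)
      show "finite (\<Union>q\<in>R'. F2 a b q)" using fin by (auto simp: F2_def)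
      show "?h ` ?H \<subseteq> (\<Union>q\<in>R'. F2 a b q)"
      proof
        fix n assume "n \<in> ?h ` ?H"
        then obtain m q where mq: "m \<in> {2..N}" "q \<in> R'" "a dvd m" "b * q dvd ?h m" "n = ?h m" by auto
        have "int n = int m + s" using h[of m] mq by simp
        then have "n \<in> {1..N+1}" "int a dvd int n + (- s)" using mq s by auto
        then show "n \<in> (\<Union>q\<in>R'. F2 a b q)" using mq by (auto simp: F2_def)
      qed
    qed
    also have "card (\<Union>q\<in>R'. F2 a b q) \<le> (\<Sum>q\<in>R'. card (F2 a b q))" using fin by (intro card_UN_le) auto
    finally show ?thesis by simp
  qed
  \<comment> \<open>Fewer than 15 primes above \<open>X\<^sup>0\<^sup>.\<^sup>0\<^sup>7\<close> divide a number below \<open>X\<^sup>1\<^sup>.\<^sup>0\<^sup>5\<close>, so there are at most \<open>14\<^sup>2\<close> choices for each of \<open>a\<close> and \<open>b\<close>.\<close>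
  have mult: "(\<Sum>a\<in>?A. \<Sum>b\<in>?B. real (card {m\<in>?G. a dvd m \<and> b dvd ?h m})) \<le> 14 ^ 4 * real (card ?G)"
  proof -
    have finG: "finite ?G" by (simp add: ordered_smooth_def)
    have "(\<Sum>a\<in>?A. \<Sum>b\<in>?B. real (card {m\<in>?G. a dvd m \<and> b dvd ?h m}))
       = (\<Sum>a\<in>?A. \<Sum>b\<in>?B. \<Sum>m\<in>?G. of_bool (a dvd m) * of_bool (b dvd ?h m))"
      using finG by (simp add: of_bool_conj[symmetric] Int_def)
    also have "\<dots> = (\<Sum>a\<in>?A. \<Sum>m\<in>?G. \<Sum>b\<in>?B. of_bool (a dvd m) * of_bool (b dvd ?h m))"
      by (intro sum.cong refl sum.swap)
    also have "\<dots> = (\<Sum>m\<in>?G. \<Sum>a\<in>?A. \<Sum>b\<in>?B. of_bool (a dvd m) * of_bool (b dvd ?h m))"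
      by (rule sum.swap)
    also have "\<dots> = (\<Sum>m\<in>?G. real (card {a\<in>?A. a dvd m}) * real (card {b\<in>?B. b dvd ?h m}))"
      unfolding sum_product[symmetric] using finAB by (simp add: Int_def)
    also have "\<dots> \<le> (\<Sum>m\<in>?G. real (14 * 14) * real (14 * 14))"
    proof (intro sum_mono mult_mono of_nat_mono)
      fix m assume "m \<in> ?G"
      then have m: "2 \<le> m" "m \<le> N" by (auto simp: ordered_smooth_def)
      have hm: "?h m \<ge> 1" "?h m \<le> N + 1" using m s by auto
      show "card {a\<in>?A. a dvd m} \<le> 14 * 14"
        using m ST ge1 N(3) by (intro card_products_dividing_le[where z = "X powr (70/1000)"]) (auto simp: X_def)
      have "real (?h m) \<le> X + 1" using hm(2) unfolding X_def by linarith
      then show "card {b\<in>?B. b dvd ?h m} \<le> 14 * 14"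
        using hm PU ge1 N(3) by (intro card_products_dividing_le[where z = "X powr (70/1000)"]) auto
    qed auto
    also have "\<dots> = 14 ^ 4 * real (card ?G)" by simp
    finally show ?thesis .
  qed
  have "(\<Sum>a\<in>?A. \<Sum>b\<in>?B. real (card (F a b))) \<le>
     (\<Sum>a\<in>?A. \<Sum>b\<in>?B. real (card {m\<in>?G. a dvd m \<and> b dvd ?h m}) + (\<Sum>q\<in>R. real (card (F1 a b q))) + (\<Sum>q\<in>R'. real (card (F2 a b q))))"
    using split by (intro sum_mono) (simp only: of_nat_add[symmetric] of_nat_sum[symmetric] of_nat_le_iff)
  also have "\<dots> = (\<Sum>a\<in>?A. \<Sum>b\<in>?B. real (card {m\<in>?G. a dvd m \<and> b dvd ?h m})) +
      (\<Sum>a\<in>?A. \<Sum>b\<in>?B. \<Sum>q\<in>R. real (card (F1 a b q))) + (\<Sum>a\<in>?A. \<Sum>b\<in>?B. \<Sum>q\<in>R'. real (card (F2 a b q)))"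
    by (simp add: sum.distrib)
  finally have "X * sA * sB - 2 * X powr (904/1000) \<le> 14 ^ 4 * real (card ?G) + (X * sA * sB * r + dispersion_error X)
      + ((X + 1) * sA * sB * r' + dispersion_error X)"
    using lower bad1 bad2 mult by linarith
  moreover have "X * sA * sB * r \<le> (X + 1) * sA * sB * r"
    by (intro mult_right_mono) (auto simp: sA_def sB_def r_def intro!: sum_nonneg mult_nonneg_nonneg)
  ultimately have "sA * sB * (X - (X + 1) * (r + r')) - 2 * X powr (904/1000) - 2 * dispersion_error X \<le> 14 ^ 4 * real (card ?G)"
    by (simp add: algebra_simps)
  then show ?thesis unfolding sA_def sB_def r_def r'_def by simp
qed

lemma dispersion_error_negligible:
  assumes "\<eta> > 0"
  shows "eventually (\<lambda>x. 2 * x powr (904/1000) + 2 * dispersion_error x \<le> \<eta> * x) at_top"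
proof -
  have "((\<lambda>x. (2 * x powr (904/1000) + 2 * dispersion_error x) / x) \<longlongrightarrow> 0) at_top"
    unfolding dispersion_error_def by real_asymp
  then have "eventually (\<lambda>x. (2 * x powr (904/1000) + 2 * dispersion_error x) / x < \<eta>) at_top"
    using assms by (rule order_tendstoD(2))
  then show ?thesis using eventually_gt_at_top[of 0]
    by eventually_elim (simp add: field_simps)
qed

text \<open>The removed triples are a proportion of less than one: for each of the two members the sum of \<open>1 / q\<close> over the excluded
primes is at most \<open>(0.551 - 0.38) / 0.38 + o(1)\<close>, which is below \<open>0.48\<close>.\<close>

lemma ordered_smooth_positive_density:
  obtains \<kappa> N\<^sub>0 where "\<kappa> > 0"
    "\<And>N s. N \<ge> N\<^sub>0 \<Longrightarrow> \<bar>s\<bar> = 1 \<Longrightarrow> \<kappa> * real N \<le> real (card (ordered_smooth N s (real N powr (381/1000))))"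
proof -
  obtain C where C: "C > 0"
    "\<And>z w. 1 < z \<Longrightarrow> z \<le> w \<Longrightarrow> (\<Sum>p\<in>primes_between z w. 1 / real p) \<le> (ln w - ln z + C) / ln z"
    "\<And>z w. 1 < z \<Longrightarrow> z \<le> w \<Longrightarrow> (\<Sum>p\<in>primes_between z w. 1 / real p) \<ge> (ln w - ln z - C) / ln w"
    using sum_inverse_primes_between by metis
  \<comment> \<open>A lower bound for the product of the four sums of reciprocals of primes.\<close>
  define \<delta> :: real where "\<delta> = (1/1000)^4"
  have \<delta>: "\<delta> > 0" by (simp add: \<delta>_def)
  define good where "good = (\<lambda>x::real. x \<ge> 48 \<and> ln x \<ge> 2000 * C \<and> ln x \<ge> 2000 \<and>
     2 * x powr (93/100) < (x powr (379/1000)) ^ 3 \<and> x + 1 < (x powr (70/1000)) ^ 15 \<and>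
     2 * x powr (904/1000) + 2 * dispersion_error x \<le> (\<delta> / 100) * x)"
  have "eventually good at_top"
    unfolding good_def
  proof (intro eventually_conj)
    show "eventually (\<lambda>x::real. 2 * x powr (93/100) < (x powr (379/1000)) ^ 3) at_top" by real_asymp
    show "eventually (\<lambda>x::real. x + 1 < (x powr (70/1000)) ^ 15) at_top" by real_asymp
    show "eventually (\<lambda>x::real. ln x \<ge> 2000 * C) at_top" by real_asymp
    show "eventually (\<lambda>x::real. ln x \<ge> 2000) at_top" by real_asymp
    show "eventually (\<lambda>x::real. x \<ge> 48) at_top" by (rule eventually_ge_at_top)
    show "eventually (\<lambda>x. 2 * x powr (904/1000) + 2 * dispersion_error x \<le> (\<delta> / 100) * x) at_top"
      using \<delta> by (intro dispersion_error_negligible) simp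
  qed
  then obtain X\<^sub>0 where X0: "\<And>x. x \<ge> X\<^sub>0 \<Longrightarrow> good x" by (auto simp: eventually_at_top_linorder)
  show ?thesis
  proof (rule that[of "\<delta> / (100 * 14 ^ 4)" "nat \<lceil>X\<^sub>0\<rceil>"])
    show "\<delta> / (100 * 14 ^ 4) > 0" using \<delta> by simp
    fix N :: nat and s :: int assume N: "N \<ge> nat \<lceil>X\<^sub>0\<rceil>" and s: "\<bar>s\<bar> = 1"
    define X where "X = real N"
    have "good X" using N by (intro X0) (simp add: X_def ceiling_le_iff nat_le_iff)
    then have X: "X \<ge> 48" "ln X \<ge> 2000 * C" "ln X \<ge> 2000" "2 * X powr (93/100) < (X powr (379/1000)) ^ 3"
      "X + 1 < (X powr (70/1000)) ^ 15" "2 * X powr (904/1000) + 2 * dispersion_error X \<le> (\<delta> / 100) * X"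
      by (auto simp: good_def)
    have big: "1 / 1000 \<le> (\<Sum>p\<in>primes_between (X powr u) (X powr v). 1 / real p)"
      if "0 < u" "v = u + 1/1000" "v \<le> 1/2" for u v
    proof -
      have "1 < X powr u" using X that by (intro gr_one_powr) auto
      moreover have "X powr u \<le> X powr v" using X that by (intro powr_mono) auto
      ultimately have "(ln (X powr v) - ln (X powr u) - C) / ln (X powr v) \<le> (\<Sum>p\<in>primes_between (X powr u) (X powr v). 1 / real p)"
        by (rule C(3))
      moreover have "1 / 1000 \<le> (ln (X powr v) - ln (X powr u) - C) / ln (X powr v)"
      proof -
        have "v * ln X \<le> 1/2 * ln X" using X that by (intro mult_right_mono) auto
        moreover have "v * ln X > 0" using X that by simp
        moreover have "v * ln X - u * ln X = ln X / 1000" using that by (simp add: algebra_simps)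
        moreover have "ln (X powr v) = v * ln X" "ln (X powr u) = u * ln X" using X by (simp_all add: ln_powr)
        moreover have "1/1000 * (v * ln X) \<le> v * ln X - u * ln X - C"
          using calculation(1,3) X(2) by linarith
        ultimately show ?thesis by (simp only: pos_le_divide_eq)
      qed
      ultimately show ?thesis by linarith
    qed
    have small: "(\<Sum>p\<in>primes_between (X powr u) (2 * X powr (551/1000)). 1 / real p) \<le> 48/100"
      if u: "380/1000 \<le> u" "u \<le> 381/1000" for u
    proof -
      have "1 < X powr u" using X that by (intro gr_one_powr) auto
      moreover have "X powr u \<le> X powr (551/1000)" using X that by (intro powr_mono) auto
      then have "X powr u \<le> 2 * X powr (551/1000)"
        using powr_ge_zero[of X "551/1000"] by linarith
      ultimately have "(\<Sum>p\<in>primes_between (X powr u) (2 * X powr (551/1000)). 1 / real p)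
          \<le> (ln (2 * X powr (551/1000)) - ln (X powr u) + C) / ln (X powr u)"
        by (rule C(2))
      also have "\<dots> \<le> 48/100"
      proof -
        have "380/1000 * ln X \<le> u * ln X" using X u by (intro mult_right_mono) auto
        then have "ln 2 + 551/1000 * ln X - u * ln X + C \<le> 48/100 * (u * ln X)"
          using ln_2_less_1 X(2,3) by linarith
        moreover have "ln (2 * X powr (551/1000)) = ln 2 + 551/1000 * ln X" "ln (X powr u) = u * ln X"
          using X by (simp_all add: ln_mult ln_powr)
        moreover have "u * ln X > 0" using X u by simp
        ultimately show ?thesis by (simp only: pos_divide_le_eq)
      qed
      finally show ?thesis .
    qed
    let ?\<sigma> = "\<lambda>u v. \<Sum>p\<in>primes_between (X powr u) (X powr v). 1 / real p"
    let ?\<rho> = "\<lambda>u. \<Sum>p\<in>primes_between (X powr u) (2 * X powr (551/1000)). 1 / real p"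
    define \<pi> where "\<pi> = ?\<sigma> (70/1000) (71/1000) * ?\<sigma> (379/1000) (380/1000) * (?\<sigma> (71/1000) (72/1000) * ?\<sigma> (380/1000) (381/1000))"
    have b: "1/1000 \<le> ?\<sigma> (70/1000) (71/1000)" "1/1000 \<le> ?\<sigma> (379/1000) (380/1000)" "1/1000 \<le> ?\<sigma> (71/1000) (72/1000)"
      "1/1000 \<le> ?\<sigma> (380/1000) (381/1000)" by (rule big; simp)+
    have "(1/1000 * (1/1000)) * (1/1000 * (1/1000)) \<le> \<pi>"
      unfolding \<pi>_def using b by (intro mult_mono) (auto intro: order_trans[OF _ b(1)] order_trans[OF _ b(2)] order_trans[OF _ b(3)] order_trans[OF _ b(4)] sum_nonneg)
    then have \<pi>: "\<delta> \<le> \<pi>" by (simp add: \<delta>_def eval_nat_numeral)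
    have "(X + 1) * (?\<rho> (380/1000) + ?\<rho> (381/1000)) \<le> (X + 1) * (48/100 + 48/100)"
      using small X by (intro mult_left_mono add_mono) auto
    then have "2/100 * X \<le> X - (X + 1) * (?\<rho> (380/1000) + ?\<rho> (381/1000))" using X by simp
    then have "\<delta> * (2/100 * X) \<le> \<pi> * (X - (X + 1) * (?\<rho> (380/1000) + ?\<rho> (381/1000)))"
      using \<pi> \<delta> X by (intro mult_mono) auto
    moreover have "\<pi> * (X - (X + 1) * (?\<rho> (380/1000) + ?\<rho> (381/1000))) - 2 * X powr (904/1000) - 2 * dispersion_error X
       \<le> 14 ^ 4 * real (card (ordered_smooth N s (X powr (381/1000))))"
      unfolding \<pi>_def X_def using X s by (intro ordered_smooth_lower_bound) (auto simp: X_def)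
    ultimately have "\<delta> / 100 * X \<le> 14 ^ 4 * real (card (ordered_smooth N s (X powr (381/1000))))"
      using X(6) by simp
    then show "\<delta> / (100 * 14 ^ 4) * real N \<le> real (card (ordered_smooth N s (real N powr (381/1000))))"
      by (simp add: X_def field_simps)
  qed
qed

theorem theorem1p5:
  fixes \<epsilon> :: real
  assumes "\<epsilon> > 0"
  shows "\<exists>\<kappa>>0. \<exists>x\<^sub>0::real. \<forall>x\<ge>x\<^sub>0.
    real (card {n::nat. 0 < n \<and> real n < x \<and>
      largest_prime_factor n < largest_prime_factor (n + 1) \<and>
      real (largest_prime_factor (n + 1)) < x powr (41 / 107 + \<epsilon>)}) \<ge> \<kappa> * x \<and>
    real (card {n::nat. 0 < n \<and> real n < x \<and>
      largest_prime_factor (n + 1) < largest_prime_factor n \<and>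
      real (largest_prime_factor n) < x powr (41 / 107 + \<epsilon>)}) \<ge> \<kappa> * x"
proof -
  obtain \<kappa> N\<^sub>0 where \<kappa>: "\<kappa> > 0" and dens:
    "\<And>N s. N \<ge> N\<^sub>0 \<Longrightarrow> \<bar>s\<bar> = 1 \<Longrightarrow> \<kappa> * real N \<le> real (card (ordered_smooth N s (real N powr (381/1000))))"
    using ordered_smooth_positive_density by metis
  show ?thesis
  proof (rule exI[of _ "\<kappa> / 2"], intro conjI exI[of _ "real N\<^sub>0 + 4"] allI impI)
    show "\<kappa> / 2 > 0" using \<kappa> by simp
  next
    fix x :: real assume x: "x \<ge> real N\<^sub>0 + 4"
    \<comment> \<open>Stopping at \<open>N \<le> x - 1\<close> keeps both neighbours within range for either sign.\<close>
    define N where "N = nat \<lfloor>x\<rfloor> - 1"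
    have N: "real N \<le> x - 1" "x - 2 \<le> real N" "N\<^sub>0 \<le> N" using x by (auto simp: N_def) linarith+
    have "real N powr (381/1000) \<le> x powr (381/1000)" using N by (intro powr_mono2) auto
    also have "\<dots> < x powr (41/107 + \<epsilon>)" using x assms by (intro powr_less_mono) auto
    finally have thr: "real N powr (381/1000) < x powr (41/107 + \<epsilon>)" .
    have "x / 2 \<le> real N" using N x by linarith
    then have "\<kappa> / 2 * x \<le> \<kappa> * real N" using \<kappa> by simp
    then have lower: "\<kappa> / 2 * x \<le> real (card (ordered_smooth N s (real N powr (381/1000))))" if "\<bar>s\<bar> = 1" for s
      using dens[OF N(3) that] by linarith
    have fin: "finite {n::nat. 0 < n \<and> real n < x \<and> Q n}" for Q
      by (rule finite_subset[of _ "{..nat \<lceil>x\<rceil>}"]) (auto simp: le_nat_iff, linarith)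
    let ?Up = "{n::nat. 0 < n \<and> real n < x \<and> largest_prime_factor n < largest_prime_factor (n + 1) \<and>
      real (largest_prime_factor (n + 1)) < x powr (41 / 107 + \<epsilon>)}"
    let ?Down = "{n::nat. 0 < n \<and> real n < x \<and> largest_prime_factor (n + 1) < largest_prime_factor n \<and>
      real (largest_prime_factor n) < x powr (41 / 107 + \<epsilon>)}"
    have "ordered_smooth N 1 (real N powr (381/1000)) \<subseteq> ?Up"
      using N thr by (auto simp: ordered_smooth_def nat_add_distrib)
    then have "card (ordered_smooth N 1 (real N powr (381/1000))) \<le> card ?Up"
      by (intro card_mono fin)
    then show "real (card ?Up) \<ge> \<kappa> / 2 * x" using lower[of 1] by linarith
    have "card (ordered_smooth N (-1) (real N powr (381/1000))) \<le> card ?Down"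
    proof (rule card_inj_on_le[where f = "\<lambda>m. m - 1"])
      show "inj_on (\<lambda>m. m - 1) (ordered_smooth N (-1) (real N powr (381/1000)))"
        by (auto simp: inj_on_def ordered_smooth_def)
      show "(\<lambda>m. m - 1) ` ordered_smooth N (-1) (real N powr (381/1000)) \<subseteq> ?Down"
      proof
        fix n assume "n \<in> (\<lambda>m. m - 1) ` ordered_smooth N (-1) (real N powr (381/1000))"
        then obtain m where m: "m \<in> ordered_smooth N (-1) (real N powr (381/1000))" "n = m - 1" by auto
        then have "2 \<le> m" "m \<le> N" "nat (int m + -1) = n" "m = n + 1" by (auto simp: ordered_smooth_def)
        then show "n \<in> ?Down" using m(1) N thr by (auto simp: ordered_smooth_def)
      qed
    qed (rule fin)
    then show "real (card ?Down) \<ge> \<kappa> / 2 * x" using lower[of "-1"] by linarith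
  qed
qed

end
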